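(* Assume $\lim_{|x|\to0}\frac{|Q(x)|}{|x|}=0$ and that the process disturbance satisfies $|d|\le\delta$ (at all times, during data collection and during closed-loop operation) for some known $\delta>0$. For a given $\Omega\succ0$ ($\Omega\in\mathbb S^{n\times n}$), suppose that the following semi-definite program is feasible with $\Delta:=\delta\sqrt T\,I_s$: minimize $\|X_1G_2\|$ over $P_1\in\mathbb S^{n\times n}$, $Y_1\in\mathbb R^{T\times n}$, $G_2\in\mathbb R^{T\times(S-n)}$, $\epsilon>0$ subject to $$Z_0Y_1=\begin{bmatrix}P_1\\ 0_{(S-n)\times n}\end{bmatrix},\qquad Z_0G_2=\begin{bmatrix}0_{n\times(S-n)}\\ I_{S-n}\end{bmatrix},$$ $$\begin{bmatrix}P_1-\Omega&(X_1Y_1)^\top&Y_1^\top\\ X_1Y_1&P_1-\epsilon E\Delta\Delta^\top E^\top&0_{n\times T}\\ Y_1&0_{T\times n}&\epsilon I_T\end{bmatrix}\succ0 .$$ For a feasible point, consider the control law $u=KZ(x)$ with $K=U_0\begin{bmatrix}G_1&G_2\end{bmatrix}$, $G_1:=Y_1P_1^{-1}$. Let $V(x):=x^\top P_1^{-1}x$ and $\mathcal R_\gamma:=\{x:V(x)\le\gamma\}$, where $\gamma>0$ is arbitrary. With $\ell(x)$ and $g(x,\delta)$ as defined in the context, let $\mathcal X:=\{x:\ell(x)+g(x,\delta)\le0\}$, let $\mathcal X^c$ be its complement, and let $\mathcal Z:=\mathcal R_\gamma\cap\mathcal X^c$ ($\mathcal Z$ defines all the points $x$ of $\mathcal R_\gamma$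 for which the Lyapunov difference $V(x^+)-V(x)$ can be positive; it is nonempty for any choice of $\gamma>0$). If $$V(x)+\ell(x)+g(x,\delta)\le\gamma\qquad\forall x\in\mathcal Z,$$ then $\mathcal R_\gamma$ is a robustly positively invariant set for the closed-loop system $x^+=AZ(x)+BKZ(x)+Ed$, with respect to disturbances $d(t)\in\{d\in\mathbb R^s:|d|\le\delta\}$.
   Context: Let $n,m,s,S,T$ be positive integers with $S\ge n$ (blocks of zero size are absent when $S=n$). Consider the discrete-time system $x^+=AZ(x)+Bu+Ed$, with $x\in\mathbb R^n$, $u\in\mathbb R^m$, $d\in\mathbb R^s$ an unknown process disturbance, constant matrices $A\in\mathbb R^{n\times S}$, $B\in\mathbb R^{n\times m}$ (unknown), $E\in\mathbb R^{n\times s}$ (known), and $Z(x)=\begin{bmatrix}x\\ Q(x)\end{bmatrix}$ with known $Q:\mathbb R^n\to\mathbb R^{S-n}$ containing only nonlinear functions. Data: samples satisfying $x(k+1)=AZ(x(k))+Bu(k)+Ed(k)$ for $k=0,\dots,T-1$. Define $U_0=[u(0)\ \cdots\ u(T-1)]$, $X_1=[x(1)\ \cdots\ x(T)]$, $Z_0=[Z(x(0))\ \cdots\ Z(x(T-1))]$. With $\underline\Phi:=P_1^{-1}\Omega P_1^{-1}$, define $\ell(x):=-x^\top\underline\Phi x+\ell_1(x)+\ell_2(x)+\ell_3(x)+\ell_4(x)$, where $\ell_1(x):=(2X_1G_1x+X_1G_2Q(x))^\top P_1^{-1}X_1G_2Q(x)$, $\ell_2(x):=\|\Delta\|_2\,|(2X_1G_1x+X_1G_2Q(x))^\top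 P_1^{-1}E|\,|G_2Q(x)|$, $\ell_3(x):=\|\Delta\|_2\,|2G_1x+G_2Q(x)|\,|E^\top P_1^{-1}X_1G_2Q(x)|$, $\ell_4(x):=\|\Delta\|_2^2\,\|E^\top P_1^{-1}E\|_2\,|2G_1x+G_2Q(x)|\,|G_2Q(x)|$; and $g(x,\delta):=r_1(x)\delta+r_2(x)\delta+r_3\delta^2$, where $r_1(x):=2|(X_1G_1x+X_1G_2Q(x))^\top P_1^{-1}E|$, $r_2(x):=2\|\Delta\|_2\|E^\top P_1^{-1}E\|_2\,|G_1x+G_2Q(x)|$, $r_3:=\|E^\top P_1^{-1}E\|_2$. A set $\mathcal S$ is robustly positively invariant for $x^+=f(x,d)$, with respect to a compact set $\mathcal I$ of disturbance values, if for every $x(0)\in\mathcal S$ and all $d(t)\in\mathcal I$ the solution satisfies $x(t)\in\mathcal S$ for $t>0$. $\mathbb S^{n\times n}$: real symmetric matrices; $\succ$: positive definite order; $|\cdot|$: Euclidean norm; $\|\cdot\|_2$: induced 2-norm; $\|\cdot\|$: any norm.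
   Formalization: The remark that Z is nonempty for any γ>0 is stated only for E≠0; it fails for E=0 (e.g. S=n, where g=0 and ℓ(x)=-xᵀP₁⁻¹ΩP₁⁻¹x≤0, so Z is empty). The invariance claim itself needs no such restriction. *)

theory Defs
  imports Complex_Main "Jordan_Normal_Form.Matrix" "Jordan_Normal_Form.Gauss_Jordan_Elimination"
begin

(* Matrices and vectors carry their dimensions explicitly, so that blocks of size zero
   (the case S = n) are ordinary objects and need no separate treatment. *)

definition vnorm :: "real vec \<Rightarrow> real" where
  "vnorm v = sqrt (v \<bullet> v)"

definition norm2 :: "real mat \<Rightarrow> real" where
  "norm2 M = (SUP v\<in>{v \<in> carrier_vec (dim_col M). vnorm v \<le> 1}. vnorm (M *\<^sub>v v))"

(* None (a singular argument) is mapped to an unspecified value; the definition is only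
   applied to positive definite matrices. *)
definition minv :: "real mat \<Rightarrow> real mat" where
  "minv M = the (mat_inverse M)"

definition sym_mat :: "nat \<Rightarrow> real mat \<Rightarrow> bool" where
  "sym_mat k M \<longleftrightarrow> M \<in> carrier_mat k k \<and> transpose_mat M = M"

definition pos_def :: "nat \<Rightarrow> real mat \<Rightarrow> bool" where
  "pos_def k M \<longleftrightarrow> sym_mat k M \<and> (\<forall>v\<in>carrier_vec k. v \<noteq> 0\<^sub>v k \<longrightarrow> 0 < v \<bullet> (M *\<^sub>v v))"

definition append_cols :: "real mat \<Rightarrow> real mat \<Rightarrow> real mat" where
  "append_cols M N = four_block_mat M N (0\<^sub>m 0 (dim_col M)) (0\<^sub>m 0 (dim_col N))"

(* Each of the q components of Q fails to be a linear functional. *)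
definition nonlinear_components :: "nat \<Rightarrow> nat \<Rightarrow> (real vec \<Rightarrow> real vec) \<Rightarrow> bool" where
  "nonlinear_components n q Q \<longleftrightarrow>
     (\<forall>i<q. \<not> (\<exists>c\<in>carrier_vec n. \<forall>x\<in>carrier_vec n. Q x $ i = c \<bullet> x))"

(* The filter for the limit |x| -> 0 over the vectors of dimension n; x = 0 is excluded. *)
definition norm_to_zero :: "nat \<Rightarrow> real vec filter" where
  "norm_to_zero n = inf (filtercomap vnorm (at_right 0)) (principal (carrier_vec n))"

definition Zmap :: "(real vec \<Rightarrow> real vec) \<Rightarrow> real vec \<Rightarrow> real vec" where
  "Zmap Q x = x @\<^sub>v Q x"

(* The matrix with columns f 0, ..., f (T - 1), all of dimension r. *)
definition data_mat :: "nat \<Rightarrow> nat \<Rightarrow> (nat \<Rightarrow> real vec) \<Rightarrow> real mat" where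
  "data_mat r T f = mat_of_cols r (map f [0..<T])"

definition lmi_mat ::
  "nat \<Rightarrow> nat \<Rightarrow> real mat \<Rightarrow> real mat \<Rightarrow> real mat \<Rightarrow> real mat \<Rightarrow> real mat \<Rightarrow> real mat \<Rightarrow> real \<Rightarrow> real mat"
where
  "lmi_mat n T X1 E \<Delta> \<Omega> P1 Y1 \<epsilon> =
     four_block_mat
       (four_block_mat
          (P1 - \<Omega>)   (transpose_mat (X1 * Y1))
          (X1 * Y1)  (P1 - \<epsilon> \<cdot>\<^sub>m (E * \<Delta> * transpose_mat \<Delta> * transpose_mat E)))
       (transpose_mat Y1 @\<^sub>r 0\<^sub>m n T)
       (append_cols Y1 (0\<^sub>m T n))
       (\<epsilon> \<cdot>\<^sub>m 1\<^sub>m T)"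

(* q stands for S - n. *)
definition sdp_feasible ::
  "nat \<Rightarrow> nat \<Rightarrow> nat \<Rightarrow> real mat \<Rightarrow> real mat \<Rightarrow> real mat \<Rightarrow> real mat \<Rightarrow> real mat
     \<Rightarrow> real mat \<Rightarrow> real mat \<Rightarrow> real mat \<Rightarrow> real \<Rightarrow> bool"
where
  "sdp_feasible n q T Z0 X1 E \<Delta> \<Omega> P1 Y1 G2 \<epsilon> \<longleftrightarrow>
     sym_mat n P1 \<and> Y1 \<in> carrier_mat T n \<and> G2 \<in> carrier_mat T q \<and> 0 < \<epsilon> \<and>
     Z0 * Y1 = P1 @\<^sub>r 0\<^sub>m q n \<and>
     Z0 * G2 = 0\<^sub>m n q @\<^sub>r 1\<^sub>m q \<and>
     pos_def (n + n + T) (lmi_mat n T X1 E \<Delta> \<Omega> P1 Y1 \<epsilon>)"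

definition lyap :: "real mat \<Rightarrow> real vec \<Rightarrow> real" where
  "lyap P1 x = x \<bullet> (minv P1 *\<^sub>v x)"

definition sublevel :: "nat \<Rightarrow> real mat \<Rightarrow> real \<Rightarrow> real vec set" where
  "sublevel n P1 \<gamma> = {x \<in> carrier_vec n. lyap P1 x \<le> \<gamma>}"

(* In ell2 and r1 the norm of the row vector w^T P1^{-1} E is taken of its transpose. *)

definition ell1 where
  "ell1 X1 P1 G1 G2 Q x =
     (2 \<cdot>\<^sub>v (X1 *\<^sub>v (G1 *\<^sub>v x)) + X1 *\<^sub>v (G2 *\<^sub>v Q x)) \<bullet> (minv P1 *\<^sub>v (X1 *\<^sub>v (G2 *\<^sub>v Q x)))"

definition ell2 where
  "ell2 X1 E \<Delta> P1 G1 G2 Q x =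
     norm2 \<Delta>
     * vnorm (transpose_mat (minv P1 * E) *\<^sub>v (2 \<cdot>\<^sub>v (X1 *\<^sub>v (G1 *\<^sub>v x)) + X1 *\<^sub>v (G2 *\<^sub>v Q x)))
     * vnorm (G2 *\<^sub>v Q x)"

definition ell3 where
  "ell3 X1 E \<Delta> P1 G1 G2 Q x =
     norm2 \<Delta>
     * vnorm (2 \<cdot>\<^sub>v (G1 *\<^sub>v x) + G2 *\<^sub>v Q x)
     * vnorm (transpose_mat E *\<^sub>v (minv P1 *\<^sub>v (X1 *\<^sub>v (G2 *\<^sub>v Q x))))"

definition ell4 where
  "ell4 E \<Delta> P1 G1 G2 Q x =
     (norm2 \<Delta>)\<^sup>2 * norm2 (transpose_mat E * minv P1 * E)
     * vnorm (2 \<cdot>\<^sub>v (G1 *\<^sub>v x) + G2 *\<^sub>v Q x) * vnorm (G2 *\<^sub>v Q x)"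

definition ell ::
  "real mat \<Rightarrow> real mat \<Rightarrow> real mat \<Rightarrow> real mat \<Rightarrow> real mat \<Rightarrow> real mat \<Rightarrow> real mat
     \<Rightarrow> (real vec \<Rightarrow> real vec) \<Rightarrow> real vec \<Rightarrow> real"
where
  "ell X1 E \<Delta> \<Omega> P1 G1 G2 Q x =
     - (x \<bullet> ((minv P1 * \<Omega> * minv P1) *\<^sub>v x))
     + ell1 X1 P1 G1 G2 Q x + ell2 X1 E \<Delta> P1 G1 G2 Q x
     + ell3 X1 E \<Delta> P1 G1 G2 Q x + ell4 E \<Delta> P1 G1 G2 Q x"

definition r1 where
  "r1 X1 E P1 G1 G2 Q x =
     2 * vnorm (transpose_mat (minv P1 * E) *\<^sub>v (X1 *\<^sub>v (G1 *\<^sub>v x) + X1 *\<^sub>v (G2 *\<^sub>v Q x)))"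

definition r2 where
  "r2 E \<Delta> P1 G1 G2 Q x =
     2 * norm2 \<Delta> * norm2 (transpose_mat E * minv P1 * E) * vnorm (G1 *\<^sub>v x + G2 *\<^sub>v Q x)"

definition r3 where
  "r3 E P1 = norm2 (transpose_mat E * minv P1 * E)"

definition gfun ::
  "real mat \<Rightarrow> real mat \<Rightarrow> real mat \<Rightarrow> real mat \<Rightarrow> real mat \<Rightarrow> real mat
     \<Rightarrow> (real vec \<Rightarrow> real vec) \<Rightarrow> real vec \<Rightarrow> real \<Rightarrow> real"
where
  "gfun X1 E \<Delta> P1 G1 G2 Q x \<delta> =
     r1 X1 E P1 G1 G2 Q x * \<delta> + r2 E \<Delta> P1 G1 G2 Q x * \<delta> + r3 E P1 * \<delta>\<^sup>2"

definition closed_loop ::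
  "real mat \<Rightarrow> real mat \<Rightarrow> real mat \<Rightarrow> real mat \<Rightarrow> (real vec \<Rightarrow> real vec)
     \<Rightarrow> real vec \<Rightarrow> real vec \<Rightarrow> real vec"
where
  "closed_loop A B E K Q x d = A *\<^sub>v Zmap Q x + B *\<^sub>v (K *\<^sub>v Zmap Q x) + E *\<^sub>v d"

definition robustly_positively_invariant ::
  "(real vec \<Rightarrow> real vec \<Rightarrow> real vec) \<Rightarrow> real vec set \<Rightarrow> real vec set \<Rightarrow> bool"
where
  "robustly_positively_invariant f I R \<longleftrightarrow>
     (\<forall>x d. x 0 \<in> R \<and> (\<forall>t::nat. d t \<in> I) \<and> (\<forall>t. x (Suc t) = f (x t) (d t))
        \<longrightarrow> (\<forall>t>0. x t \<in> R))"

end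

theory Submission
  imports Defs "Jordan_Normal_Form.Determinant" "HOL-Analysis.L2_Norm"
begin

text \<open>The data equation gives \<open>X1 - E D0 = A Z0 + B U0\<close>, where \<open>D0\<close> collects the unknown
  disturbances, and \<open>Z0 [G1 G2] = I\<close>; so the closed loop is
  \<open>x\<^sup>+ = F (G1 x + G2 Q(x)) + E d\<close> with \<open>F = X1 - E D0\<close>. The matrix inequality, together with
  \<open>D0 D0\<^sup>T \<le> \<Delta> \<Delta>\<^sup>T\<close>, yields \<open>V(F G1 x) \<le> V(x) - x\<^sup>T P1\<^sup>-\<^sup>1 \<Omega> P1\<^sup>-\<^sup>1 x\<close>. Expanding \<open>V(x\<^sup>+)\<close> and
  bounding each remaining term that contains \<open>D0\<close> or \<open>d\<close> by Cauchy-Schwarz gives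
  \<open>V(x\<^sup>+) \<le> V(x) + \<ell>(x) + g(x, \<delta>)\<close>, from which invariance follows by a case distinction
  on the sign of \<open>\<ell>(x) + g(x, \<delta>)\<close>.\<close>

section \<open>The Euclidean norm and the induced norm\<close>

text \<open>Everything is evaluated on vectors. All that is known of D0 is |D0^T z| \<le> \<delta>
  sqrt T |z|, and Cauchy-Schwarz carries this bound over to D0 itself. Both versions are needed: the
  transposed one in the matrix inequality, where D0 D0^T enters, and the direct one in the error
  terms, where D0 acts on G1 x and G2 Q(x). A second obstacle is that feasibility only provides a
  symmetric \<open>P1\<close>, whereas V, \<ell> and g all contain its inverse; definiteness has to
  be extracted from the matrix inequality before any of them has a meaning. The shape of \<ell>
  comes from V(a + b) - V(a) = (2 a + b)^T P1^-1 b, with a the linear and b the nonlinear part of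
  the step. Nonemptiness of the set of possible increase is a separate matter: it rests on the
  constant r3 \<delta>^2 being positive, hence on E being nonzero.\<close>

lemma vnorm_eq_L2_set: "vnorm v = L2_set (\<lambda>i. v $ i) {0..<dim_vec v}"
  by (simp add: vnorm_def L2_set_def scalar_prod_def power2_eq_square)

lemma vnorm_nonneg [simp]: "0 \<le> vnorm v"
  by (simp add: vnorm_eq_L2_set)

lemma scalar_prod_self_nonneg: "0 \<le> (v :: real vec) \<bullet> v"
  by (simp add: scalar_prod_def sum_nonneg)

lemma vnorm_square: "(vnorm v)\<^sup>2 = v \<bullet> v"
  by (simp add: vnorm_def scalar_prod_self_nonneg)

lemma vnorm_eq_0_iff: "v \<in> carrier_vec k \<Longrightarrow> vnorm v = 0 \<longleftrightarrow> v = 0\<^sub>v k"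
  by (auto simp: vnorm_eq_L2_set L2_set_eq_0_iff intro!: eq_vecI)

lemma vnorm_smult: "vnorm (c \<cdot>\<^sub>v v) = \<bar>c\<bar> * vnorm v"
proof -
  have "(c \<cdot>\<^sub>v v) \<bullet> (c \<cdot>\<^sub>v v) = c\<^sup>2 * (v \<bullet> v)"
    by (simp add: scalar_prod_def sum_distrib_left power2_eq_square algebra_simps)
  then show ?thesis by (simp add: vnorm_def real_sqrt_mult)
qed

lemma abs_scalar_prod_le:
  assumes "v \<in> carrier_vec k" "w \<in> carrier_vec k"
  shows "\<bar>v \<bullet> w\<bar> \<le> vnorm v * vnorm w"
proof -
  have "\<bar>v \<bullet> w\<bar> \<le> (\<Sum>i\<in>{0..<k}. \<bar>v $ i\<bar> * \<bar>w $ i\<bar>)"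
    using assms by (auto simp: scalar_prod_def abs_mult[symmetric])
  also have "\<dots> \<le> vnorm v * vnorm w"
    using assms L2_set_mult_ineq[of "\<lambda>i. v $ i" "\<lambda>i. w $ i" "{0..<k}"]
    by (simp add: vnorm_eq_L2_set)
  finally show ?thesis .
qed

text \<open>Some finite constant is needed so that the supremum in \<open>norm2\<close> ranges over
  a bounded set. The sum of the row norms is crude, but its value enters no later bound.\<close>

lemma mat_vec_bounded:
  assumes M: "M \<in> carrier_mat r c"
  obtains C where "0 \<le> C" "\<And>v. v \<in> carrier_vec c \<Longrightarrow> vnorm (M *\<^sub>v v) \<le> C * vnorm v"
proof
  show "0 \<le> (\<Sum>i<r. vnorm (row M i))" by (simp add: sum_nonneg)
  fix v :: "real vec" assume v: "v \<in> carrier_vec c"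
  have "vnorm (M *\<^sub>v v) \<le> (\<Sum>i<r. \<bar>(M *\<^sub>v v) $ i\<bar>)"
    using M L2_set_le_sum_abs[of "\<lambda>i. (M *\<^sub>v v) $ i" "{0..<r}"]
    by (simp add: vnorm_eq_L2_set atLeast0LessThan)
  also have "\<dots> \<le> (\<Sum>i<r. vnorm (row M i) * vnorm v)"
    using M v by (intro sum_mono) (auto intro!: abs_scalar_prod_le)
  finally show "vnorm (M *\<^sub>v v) \<le> (\<Sum>i<r. vnorm (row M i)) * vnorm v"
    by (simp add: sum_distrib_right)
qed

lemma vnorm_mult_unit_ball_le:
  assumes M: "M \<in> carrier_mat r c" and v: "v \<in> carrier_vec c" "vnorm v \<le> 1"
  shows "vnorm (M *\<^sub>v v) \<le> norm2 M"
proof -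
  obtain C where C: "0 \<le> C" "\<And>v. v \<in> carrier_vec c \<Longrightarrow> vnorm (M *\<^sub>v v) \<le> C * vnorm v"
    using mat_vec_bounded[OF M] by blast
  have bdd: "bdd_above ((\<lambda>v. vnorm (M *\<^sub>v v)) ` {v \<in> carrier_vec (dim_col M). vnorm v \<le> 1})"
  proof (rule bdd_aboveI2)
    fix w assume w: "w \<in> {v \<in> carrier_vec (dim_col M). vnorm v \<le> 1}"
    then have "vnorm (M *\<^sub>v w) \<le> C * vnorm w" using C M by auto
    also have "\<dots> \<le> C * 1" using w C by (intro mult_left_mono) auto
    finally show "vnorm (M *\<^sub>v w) \<le> C" by simp
  qed
  show ?thesis
    unfolding norm2_def using M v by (intro cSUP_upper[OF _ bdd]) auto
qed

lemma norm2_nonneg [simp]: "0 \<le> norm2 M"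
proof -
  have "vnorm (M *\<^sub>v 0\<^sub>v (dim_col M)) \<le> norm2 M"
    by (rule vnorm_mult_unit_ball_le[of M "dim_row M" "dim_col M"]) (simp_all add: vnorm_def)
  then show ?thesis using vnorm_nonneg order_trans by blast
qed

lemma vnorm_mult_mat_vec_le:
  assumes M: "M \<in> carrier_mat r c" and v: "v \<in> carrier_vec c"
  shows "vnorm (M *\<^sub>v v) \<le> norm2 M * vnorm v"
proof (cases "vnorm v = 0")
  case True
  \<comment> \<open>A vector of norm zero cannot be normalised; the crude bound shows that its image
    has norm zero as well.\<close>
  obtain C where "\<And>v. v \<in> carrier_vec c \<Longrightarrow> vnorm (M *\<^sub>v v) \<le> C * vnorm v"
    using mat_vec_bounded[OF M] by blast
  with v True show ?thesis by fastforce
next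
  case False
  define w where "w = inverse (vnorm v) \<cdot>\<^sub>v v"
  have "w \<in> carrier_vec c" "vnorm w \<le> 1" using v False by (simp_all add: w_def vnorm_smult)
  then have "vnorm (M *\<^sub>v w) \<le> norm2 M" by (rule vnorm_mult_unit_ball_le[OF M])
  moreover have "vnorm (M *\<^sub>v w) = inverse (vnorm v) * vnorm (M *\<^sub>v v)"
    using mult_mat_vec[OF M v] by (simp add: w_def vnorm_smult)
  ultimately show ?thesis using False by (simp add: field_simps order_less_le)
qed

text \<open>For \<open>\<Delta>\<close>: the bound on the data must not exceed the factor
  \<open>norm2 \<Delta>\<close> in \<ell> and g. A unit vector witnesses this; in dimension 0 there
  is none and the norm is 0.\<close>

lemma norm2_smult_one_ge:
  assumes "0 < k" "0 \<le> c"
  shows "c \<le> norm2 (c \<cdot>\<^sub>m 1\<^sub>m k)"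
proof -
  have u: "vnorm (unit_vec k 0) = 1" using assms by (simp add: vnorm_def)
  have "(c \<cdot>\<^sub>m 1\<^sub>m k) *\<^sub>v unit_vec k 0 = c \<cdot>\<^sub>v unit_vec k 0"
    using assms by (intro eq_vecI) auto
  then show ?thesis
    using vnorm_mult_mat_vec_le[of "c \<cdot>\<^sub>m 1\<^sub>m k" k k "unit_vec k 0"] u assms
    by (simp add: vnorm_smult)
qed

lemma smult_mat_mult_vec:
  "M \<in> carrier_mat r k \<Longrightarrow> v \<in> carrier_vec k \<Longrightarrow> (c \<cdot>\<^sub>m M) *\<^sub>v v = c \<cdot>\<^sub>v (M *\<^sub>v v)"
  for M :: "real mat"
  by (intro eq_vecI) auto

lemma zero_mat_mult_vec: "v \<in> carrier_vec k \<Longrightarrow> 0\<^sub>m r k *\<^sub>v v = (0\<^sub>v r :: real vec)"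
  by (intro eq_vecI) auto

lemma mat_mult_zero_vec: "M \<in> carrier_mat r k \<Longrightarrow> M *\<^sub>v 0\<^sub>v k = (0\<^sub>v r :: real vec)"
  by (intro eq_vecI) auto

lemma transpose_mult_mult_vec:
  fixes P :: "real mat"
  assumes "P \<in> carrier_mat n n" "E \<in> carrier_mat n s" "v \<in> carrier_vec s"
  shows "(transpose_mat E * P * E) *\<^sub>v v = transpose_mat E *\<^sub>v (P *\<^sub>v (E *\<^sub>v v))"
  unfolding assoc_mult_mat_vec[OF mult_carrier_mat[OF transpose_carrier_mat[THEN iffD2, OF assms(2)] assms(1)] assms(2,3)]
  using assms by (intro assoc_mult_mat_vec[of _ s n _ n]) auto

text \<open>If the norm were zero, then (E v)^T P (E v) = 0 for every v, and definiteness would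
  force E v = 0 on all unit vectors. With the inverse of \<open>P1\<close> as \<open>P\<close>, this
  makes \<open>r3\<close> strictly positive.\<close>

lemma norm2_transpose_mult_pos:
  assumes P: "pos_def n P" and E: "E \<in> carrier_mat n s" and nz: "E \<noteq> 0\<^sub>m n s"
  shows "0 < norm2 (transpose_mat E * P * E)"
proof (rule ccontr)
  assume "\<not> ?thesis"
  then have z: "norm2 (transpose_mat E * P * E) = 0" using norm2_nonneg[of "transpose_mat E * P * E"] by simp
  have Pc: "P \<in> carrier_mat n n" using P by (simp add: pos_def_def sym_mat_def)
  have "E *\<^sub>v v = 0\<^sub>v n" if v: "v \<in> carrier_vec s" for v
  proof (rule ccontr)
    assume ne: "E *\<^sub>v v \<noteq> 0\<^sub>v n"
    have M: "transpose_mat E * P * E \<in> carrier_mat s s" using E Pc by simp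
    have "vnorm ((transpose_mat E * P * E) *\<^sub>v v) \<le> 0"
      using vnorm_mult_mat_vec_le[OF M v] z by simp
    then have "(transpose_mat E * P * E) *\<^sub>v v = 0\<^sub>v s"
      using vnorm_eq_0_iff[of "(transpose_mat E * P * E) *\<^sub>v v" s] M v
      by (metis vnorm_nonneg order_antisym mult_mat_vec_carrier)
    then have "transpose_mat E *\<^sub>v (P *\<^sub>v (E *\<^sub>v v)) = 0\<^sub>v s"
      using transpose_mult_mult_vec[OF Pc E v] by simp
    then have "(P *\<^sub>v (E *\<^sub>v v)) \<bullet> (E *\<^sub>v v) = 0"
      using transpose_vec_mult_scalar[OF E v, of "P *\<^sub>v (E *\<^sub>v v)"] E Pc v by simp
    moreover have "0 < (E *\<^sub>v v) \<bullet> (P *\<^sub>v (E *\<^sub>v v))"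
      using P E v ne by (simp add: pos_def_def)
    ultimately show False
      using comm_scalar_prod[of "E *\<^sub>v v" n "P *\<^sub>v (E *\<^sub>v v)"] E v Pc by simp
  qed
  then have "E *\<^sub>v unit_vec s j = 0\<^sub>v n" for j by simp
  moreover have "(E *\<^sub>v unit_vec s j) $ i = E $$ (i, j)" if "i < n" "j < s" for i j
    using that E by simp
  ultimately have "E = 0\<^sub>m n s" using E by (intro eq_matI) auto
  with nz show False by simp
qed


section \<open>Symmetric bilinear forms\<close>

lemma sym_matD: "sym_mat n P \<Longrightarrow> P \<in> carrier_mat n n"
  by (simp add: sym_mat_def)

lemma pos_defD:
  assumes "pos_def n P"
  shows "sym_mat n P" "v \<in> carrier_vec n \<Longrightarrow> v \<noteq> 0\<^sub>v n \<Longrightarrow> 0 < v \<bullet> (P *\<^sub>v v)"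
  using assms by (auto simp: pos_def_def)

lemma pos_def_nonneg:
  assumes "pos_def n P" "v \<in> carrier_vec n"
  shows "0 \<le> v \<bullet> (P *\<^sub>v v)"
proof (cases "v = 0\<^sub>v n")
  case True
  then show ?thesis using assms by (simp add: pos_def_def sym_mat_def mat_mult_zero_vec[of _ n n])
next
  case False
  then show ?thesis using pos_defD(2)[OF assms] by simp
qed

lemma sym_mat_form_commute:
  assumes P: "sym_mat n P" and "u \<in> carrier_vec n" "v \<in> carrier_vec n"
  shows "u \<bullet> (P *\<^sub>v v) = v \<bullet> (P *\<^sub>v u)"
proof -
  have "u \<bullet> (P *\<^sub>v v) = (P *\<^sub>v u) \<bullet> v"
    using transpose_vec_mult_scalar[of P n n v u] assms by (simp add: sym_mat_def)
  also have "\<dots> = v \<bullet> (P *\<^sub>v u)"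
    using assms by (intro comm_scalar_prod[of _ n]) (auto simp: sym_mat_def)
  finally show ?thesis .
qed

lemma form_linear:
  fixes P :: "real mat"
  assumes P: "P \<in> carrier_mat n k" and u: "u \<in> carrier_vec n" "u' \<in> carrier_vec n"
    and v: "v \<in> carrier_vec k" "v' \<in> carrier_vec k"
  shows "(u + u') \<bullet> (P *\<^sub>v v) = u \<bullet> (P *\<^sub>v v) + u' \<bullet> (P *\<^sub>v v)"
    and "(u - u') \<bullet> (P *\<^sub>v v) = u \<bullet> (P *\<^sub>v v) - u' \<bullet> (P *\<^sub>v v)"
    and "(c \<cdot>\<^sub>v u) \<bullet> (P *\<^sub>v v) = c * (u \<bullet> (P *\<^sub>v v))"
    and "(- u) \<bullet> (P *\<^sub>v v) = - (u \<bullet> (P *\<^sub>v v))"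
    and "u \<bullet> (P *\<^sub>v (v + v')) = u \<bullet> (P *\<^sub>v v) + u \<bullet> (P *\<^sub>v v')"
    and "u \<bullet> (P *\<^sub>v (v - v')) = u \<bullet> (P *\<^sub>v v) - u \<bullet> (P *\<^sub>v v')"
    and "u \<bullet> (P *\<^sub>v (c \<cdot>\<^sub>v v)) = c * (u \<bullet> (P *\<^sub>v v))"
    and "u \<bullet> (P *\<^sub>v (- v)) = - (u \<bullet> (P *\<^sub>v v))"
proof -
  have m: "- v = (-1) \<cdot>\<^sub>v v" "- u = (-1) \<cdot>\<^sub>v u" by (auto intro: eq_vecI)
  show "(u + u') \<bullet> (P *\<^sub>v v) = u \<bullet> (P *\<^sub>v v) + u' \<bullet> (P *\<^sub>v v)"
    using assms by (intro add_scalar_prod_distrib[of _ n]) auto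
  show "(u - u') \<bullet> (P *\<^sub>v v) = u \<bullet> (P *\<^sub>v v) - u' \<bullet> (P *\<^sub>v v)"
    using assms by (intro minus_scalar_prod_distrib[of _ n]) auto
  show c1: "(c \<cdot>\<^sub>v u) \<bullet> (P *\<^sub>v v) = c * (u \<bullet> (P *\<^sub>v v))" for c
    using assms by (intro smult_scalar_prod_distrib[of _ n]) auto
  show "(- u) \<bullet> (P *\<^sub>v v) = - (u \<bullet> (P *\<^sub>v v))"
    unfolding m by (simp add: c1)
  show "u \<bullet> (P *\<^sub>v (v + v')) = u \<bullet> (P *\<^sub>v v) + u \<bullet> (P *\<^sub>v v')"
    unfolding mult_add_distrib_mat_vec[OF P v]
    using assms by (intro scalar_prod_add_distrib[of _ n]) auto
  show "u \<bullet> (P *\<^sub>v (v - v')) = u \<bullet> (P *\<^sub>v v) - u \<bullet> (P *\<^sub>v v')"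
    unfolding mult_minus_distrib_mat_vec[OF P v]
    using assms by (intro scalar_prod_minus_distrib[of _ n]) auto
  show c2: "u \<bullet> (P *\<^sub>v (c \<cdot>\<^sub>v v)) = c * (u \<bullet> (P *\<^sub>v v))" for c
    unfolding mult_mat_vec[OF P v(1)]
    using assms by (intro scalar_prod_smult_distrib[of _ n]) auto
  show "u \<bullet> (P *\<^sub>v (- v)) = - (u \<bullet> (P *\<^sub>v v))"
    unfolding m by (simp add: c2)
qed

text \<open>With a = p1 - q1 and b = p2 - q2, the form at a + b + r is the form at a plus (2 a +
  b)^T P b + 2 (a + b)^T P r + r^T P r. Splitting each factor into its known part p and its
  uncertain part q gives exactly the terms behind \<open>ell1\<close> to \<open>ell4\<close> and
  \<open>r1\<close> to \<open>r3\<close>, in this order.\<close>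

lemma form_expand_step:
  assumes P: "sym_mat n P"
    and c: "p1 \<in> carrier_vec n" "p2 \<in> carrier_vec n" "q1 \<in> carrier_vec n" "q2 \<in> carrier_vec n"
      "r \<in> carrier_vec n"
  shows "((p1 - q1) + (p2 - q2) + r) \<bullet> (P *\<^sub>v ((p1 - q1) + (p2 - q2) + r)) =
     (p1 - q1) \<bullet> (P *\<^sub>v (p1 - q1))
     + (2 \<cdot>\<^sub>v p1 + p2) \<bullet> (P *\<^sub>v p2) - (2 \<cdot>\<^sub>v p1 + p2) \<bullet> (P *\<^sub>v q2)
     - (2 \<cdot>\<^sub>v q1 + q2) \<bullet> (P *\<^sub>v p2) + (2 \<cdot>\<^sub>v q1 + q2) \<bullet> (P *\<^sub>v q2)
     + 2 * ((p1 + p2) \<bullet> (P *\<^sub>v r)) - 2 * ((q1 + q2) \<bullet> (P *\<^sub>v r)) + r \<bullet> (P *\<^sub>v r)"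
proof -
  \<comment> \<open>Ten instances follow, one for each pair of distinct vectors among the five; each
    fixes an orientation, so that like cross terms combine.\<close>
  note com = sym_mat_form_commute[OF P]
  show ?thesis
    using c
    by (simp add: form_linear[OF sym_matD[OF P]] com[of p2 p1] com[of q1 p1] com[of q2 p1] com[of r p1]
        com[of q1 p2] com[of q2 p2] com[of r p2] com[of q2 q1] com[of r q1] com[of r q2])
qed

text \<open>Cauchy-Schwarz after moving \<open>E\<close> across the product. The uncertain vector
  may stand on the right (as for \<open>ell2\<close> and \<open>r1\<close>), on the left
  (\<open>ell3\<close>), or on both sides (\<open>ell4\<close>, \<open>r2\<close>,
  \<open>r3\<close>), which explains the different norms in these terms.\<close>

lemma form_matrix_bounds:
  assumes P: "sym_mat n P" and E: "E \<in> carrier_mat n s" and u: "u \<in> carrier_vec n"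
    and e: "e \<in> carrier_vec s" and f: "f \<in> carrier_vec s"
  shows "\<bar>u \<bullet> (P *\<^sub>v (E *\<^sub>v e))\<bar> \<le> vnorm (transpose_mat (P * E) *\<^sub>v u) * vnorm e"
    and "\<bar>(E *\<^sub>v e) \<bullet> (P *\<^sub>v u)\<bar> \<le> vnorm e * vnorm (transpose_mat E *\<^sub>v (P *\<^sub>v u))"
    and "\<bar>(E *\<^sub>v e) \<bullet> (P *\<^sub>v (E *\<^sub>v f))\<bar> \<le> norm2 (transpose_mat E * P * E) * vnorm e * vnorm f"
proof -
  have Pc: "P \<in> carrier_mat n n" by (rule sym_matD[OF P])
  have PE: "P * E \<in> carrier_mat n s" using Pc E by simp
  have "u \<bullet> (P *\<^sub>v (E *\<^sub>v e)) = (transpose_mat (P * E) *\<^sub>v u) \<bullet> e"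
    using transpose_vec_mult_scalar[OF PE e u] Pc E e by simp
  then show "\<bar>u \<bullet> (P *\<^sub>v (E *\<^sub>v e))\<bar> \<le> vnorm (transpose_mat (P * E) *\<^sub>v u) * vnorm e"
    using abs_scalar_prod_le[of "transpose_mat (P * E) *\<^sub>v u" s e] PE u e by simp
  have E2: "(E *\<^sub>v e) \<bullet> (P *\<^sub>v v) = e \<bullet> (transpose_mat E *\<^sub>v (P *\<^sub>v v))" if v: "v \<in> carrier_vec n" for v
    using transpose_vec_mult_scalar[of "transpose_mat E" s n "P *\<^sub>v v" e] E Pc v e
    by simp
  have B: "\<bar>(E *\<^sub>v e) \<bullet> (P *\<^sub>v v)\<bar> \<le> vnorm e * vnorm (transpose_mat E *\<^sub>v (P *\<^sub>v v))"
    if v: "v \<in> carrier_vec n" for v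
    unfolding E2[OF v] using E Pc v e by (intro abs_scalar_prod_le[of _ s]) auto
  show "\<bar>(E *\<^sub>v e) \<bullet> (P *\<^sub>v u)\<bar> \<le> vnorm e * vnorm (transpose_mat E *\<^sub>v (P *\<^sub>v u))"
    by (rule B[OF u])
  have "vnorm (transpose_mat E *\<^sub>v (P *\<^sub>v (E *\<^sub>v f))) = vnorm ((transpose_mat E * P * E) *\<^sub>v f)"
    by (simp only: transpose_mult_mult_vec[OF Pc E f])
  also have "\<dots> \<le> norm2 (transpose_mat E * P * E) * vnorm f"
    using E Pc f by (intro vnorm_mult_mat_vec_le[of _ s s]) auto
  finally have "vnorm e * vnorm (transpose_mat E *\<^sub>v (P *\<^sub>v (E *\<^sub>v f)))
      \<le> vnorm e * (norm2 (transpose_mat E * P * E) * vnorm f)"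
    by (intro mult_left_mono) auto
  with B[of "E *\<^sub>v f"] E f
  show "\<bar>(E *\<^sub>v e) \<bullet> (P *\<^sub>v (E *\<^sub>v f))\<bar> \<le> norm2 (transpose_mat E * P * E) * vnorm e * vnorm f"
    by (simp add: ac_simps)
qed

text \<open>The unknown data disturbance \<open>D\<close> enters only through the bound \<open>\<beta>\<close> on its norm.\<close>

lemma form_step_bound:
  assumes P: "pos_def n P" and E: "E \<in> carrier_mat n s" and X: "X \<in> carrier_mat n k"
    and D: "D \<in> carrier_mat s k"
    and bound: "\<And>v. v \<in> carrier_vec k \<Longrightarrow> vnorm (D *\<^sub>v v) \<le> \<beta> * vnorm v"
    and w: "w1 \<in> carrier_vec k" "w2 \<in> carrier_vec k"
    and d: "d \<in> carrier_vec s" "vnorm d \<le> \<delta>"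
    and y: "y = (X - E * D) *\<^sub>v (w1 + w2) + E *\<^sub>v d"
  shows "y \<bullet> (P *\<^sub>v y) \<le>
     ((X - E * D) *\<^sub>v w1) \<bullet> (P *\<^sub>v ((X - E * D) *\<^sub>v w1))
     + (2 \<cdot>\<^sub>v (X *\<^sub>v w1) + X *\<^sub>v w2) \<bullet> (P *\<^sub>v (X *\<^sub>v w2))
     + \<beta> * vnorm (transpose_mat (P * E) *\<^sub>v (2 \<cdot>\<^sub>v (X *\<^sub>v w1) + X *\<^sub>v w2)) * vnorm w2
     + \<beta> * vnorm (2 \<cdot>\<^sub>v w1 + w2) * vnorm (transpose_mat E *\<^sub>v (P *\<^sub>v (X *\<^sub>v w2)))
     + \<beta>\<^sup>2 * norm2 (transpose_mat E * P * E) * vnorm (2 \<cdot>\<^sub>v w1 + w2) * vnorm w2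
     + 2 * vnorm (transpose_mat (P * E) *\<^sub>v (X *\<^sub>v w1 + X *\<^sub>v w2)) * \<delta>
     + 2 * \<beta> * norm2 (transpose_mat E * P * E) * vnorm (w1 + w2) * \<delta>
     + norm2 (transpose_mat E * P * E) * \<delta>\<^sup>2"
proof -
  define p1 where "p1 = X *\<^sub>v w1"
  define p2 where "p2 = X *\<^sub>v w2"
  define e1 where "e1 = D *\<^sub>v w1"
  define e2 where "e2 = D *\<^sub>v w2"
  define q1 where "q1 = E *\<^sub>v e1"
  define q2 where "q2 = E *\<^sub>v e2"
  define r where "r = E *\<^sub>v d"
  note defs = p1_def p2_def e1_def e2_def q1_def q2_def r_def
  have c: "p1 \<in> carrier_vec n" "p2 \<in> carrier_vec n" "q1 \<in> carrier_vec n" "q2 \<in> carrier_vec n"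
    "r \<in> carrier_vec n" "e1 \<in> carrier_vec s" "e2 \<in> carrier_vec s"
    using X D E w d by (auto simp: defs)
  have ED: "E * D \<in> carrier_mat n k" using E D by simp
  have F: "(X - E * D) *\<^sub>v w = X *\<^sub>v w - E *\<^sub>v (D *\<^sub>v w)" if "w \<in> carrier_vec k" for w
    using that X E D ED by (simp add: minus_mult_distrib_mat_vec[OF X ED])
  have F1: "(X - E * D) *\<^sub>v w1 = p1 - q1" using F w by (simp add: defs)
  have F2: "(X - E * D) *\<^sub>v w2 = p2 - q2" using F w by (simp add: defs)
  have FC: "X - E * D \<in> carrier_mat n k" by (rule minus_carrier_mat[OF ED])
  have yy: "y = (p1 - q1) + (p2 - q2) + r"
    unfolding y mult_add_distrib_mat_vec[OF FC w] F1 F2 r_def ..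
  have ge: "0 \<le> \<delta>" using d vnorm_nonneg order_trans by blast
  define N where "N = norm2 (transpose_mat E * P * E)"
  have N: "0 \<le> N" by (simp add: N_def)
  note sP = pos_defD(1)[OF P]
  \<comment> \<open>The combinations pass through \<open>D\<close> and \<open>E\<close> as a whole,
    so that \<open>\<beta>\<close> multiplies the norm of 2 w1 + w2 and not a sum of norms;
    \<open>ell3\<close> and \<open>ell4\<close> have this form.\<close>
  have De1: "2 \<cdot>\<^sub>v e1 + e2 = D *\<^sub>v (2 \<cdot>\<^sub>v w1 + w2)" and De2: "e1 + e2 = D *\<^sub>v (w1 + w2)"
    using D w by (simp_all add: defs mult_add_distrib_mat_vec[OF D] mult_mat_vec[OF D])
  have Eq1: "2 \<cdot>\<^sub>v q1 + q2 = E *\<^sub>v (2 \<cdot>\<^sub>v e1 + e2)" and Eq2: "q1 + q2 = E *\<^sub>v (e1 + e2)"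
    using c by (simp_all add: q1_def q2_def mult_add_distrib_mat_vec[OF E] mult_mat_vec[OF E])
  have n1: "vnorm (2 \<cdot>\<^sub>v e1 + e2) \<le> \<beta> * vnorm (2 \<cdot>\<^sub>v w1 + w2)"
    unfolding De1 using w by (intro bound) simp
  have n2: "vnorm (e1 + e2) \<le> \<beta> * vnorm (w1 + w2)"
    unfolding De2 using w by (intro bound) simp
  have n3: "vnorm e2 \<le> \<beta> * vnorm w2"
    unfolding e2_def using w by (intro bound) simp
  have b2: "\<bar>(2 \<cdot>\<^sub>v p1 + p2) \<bullet> (P *\<^sub>v q2)\<bar>
      \<le> vnorm (transpose_mat (P * E) *\<^sub>v (2 \<cdot>\<^sub>v p1 + p2)) * (\<beta> * vnorm w2)"
    unfolding q2_def using c
    by (intro order_trans[OF form_matrix_bounds(1)[OF sP E _ c(7)]] mult_left_mono n3) auto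
  have b3: "\<bar>(2 \<cdot>\<^sub>v q1 + q2) \<bullet> (P *\<^sub>v p2)\<bar>
      \<le> (\<beta> * vnorm (2 \<cdot>\<^sub>v w1 + w2)) * vnorm (transpose_mat E *\<^sub>v (P *\<^sub>v p2))"
    unfolding Eq1 using c
    by (intro order_trans[OF form_matrix_bounds(2)[OF sP E c(2) _ c(7)]] mult_right_mono n1) auto
  have "\<bar>(2 \<cdot>\<^sub>v q1 + q2) \<bullet> (P *\<^sub>v q2)\<bar> \<le> N * vnorm (2 \<cdot>\<^sub>v e1 + e2) * vnorm e2"
    unfolding Eq1 unfolding q2_def N_def using c by (intro form_matrix_bounds(3)[OF sP E c(1)]) auto
  also have "\<dots> \<le> N * (\<beta> * vnorm (2 \<cdot>\<^sub>v w1 + w2)) * (\<beta> * vnorm w2)"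
    using N order_trans[OF vnorm_nonneg n1] by (intro mult_mono mult_left_mono n1 n3) auto
  finally have b4: "\<bar>(2 \<cdot>\<^sub>v q1 + q2) \<bullet> (P *\<^sub>v q2)\<bar>
      \<le> N * (\<beta> * vnorm (2 \<cdot>\<^sub>v w1 + w2)) * (\<beta> * vnorm w2)" .
  have b5: "\<bar>(p1 + p2) \<bullet> (P *\<^sub>v r)\<bar> \<le> vnorm (transpose_mat (P * E) *\<^sub>v (p1 + p2)) * \<delta>"
    unfolding r_def using c d
    by (intro order_trans[OF form_matrix_bounds(1)[OF sP E _ d(1) d(1)]] mult_left_mono d) auto
  have "\<bar>(q1 + q2) \<bullet> (P *\<^sub>v r)\<bar> \<le> N * vnorm (e1 + e2) * vnorm d"
    unfolding Eq2 r_def N_def using c d by (intro form_matrix_bounds(3)[OF sP E c(1)]) auto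
  also have "\<dots> \<le> N * (\<beta> * vnorm (w1 + w2)) * \<delta>"
    using N order_trans[OF vnorm_nonneg n2] by (intro mult_mono mult_left_mono n2 d) auto
  finally have b6: "\<bar>(q1 + q2) \<bullet> (P *\<^sub>v r)\<bar> \<le> N * (\<beta> * vnorm (w1 + w2)) * \<delta>" .
  have "\<bar>r \<bullet> (P *\<^sub>v r)\<bar> \<le> N * vnorm d * vnorm d"
    unfolding r_def N_def by (rule form_matrix_bounds(3)[OF sP E c(1) d(1) d(1)])
  also have "\<dots> \<le> N * \<delta> * \<delta>"
    using N ge by (intro mult_mono mult_left_mono d) auto
  finally have b7: "\<bar>r \<bullet> (P *\<^sub>v r)\<bar> \<le> N * \<delta> * \<delta>" .
  \<comment> \<open>With forms and norms replaced by real variables, the claim is a sum of six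
    estimates, each used with the sign that its term has in the expansion.\<close>
  have arith: "f1 + f2 - f3 - f4 + f5 + 2 * f6 - 2 * f7 + f8
      \<le> f1 + f2 + \<beta> * g3 * a3 + \<beta> * a4 * g4 + \<beta>\<^sup>2 * N * a4 * a3 + 2 * g6 * \<delta> + 2 * \<beta> * N * a7 * \<delta> + N * \<delta>\<^sup>2"
    if "\<bar>f3\<bar> \<le> g3 * (\<beta> * a3)" "\<bar>f4\<bar> \<le> (\<beta> * a4) * g4" "\<bar>f5\<bar> \<le> N * (\<beta> * a4) * (\<beta> * a3)"
      "\<bar>f6\<bar> \<le> g6 * \<delta>" "\<bar>f7\<bar> \<le> N * (\<beta> * a7) * \<delta>" "\<bar>f8\<bar> \<le> N * \<delta> * \<delta>"
    for f1 f2 f3 f4 f5 f6 f7 f8 g3 g4 g6 a3 a4 a7 :: real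
    using abs_le_D2[OF that(1)] abs_le_D2[OF that(2)] abs_le_D1[OF that(3)] abs_le_D1[OF that(4)]
      abs_le_D2[OF that(5)] abs_le_D1[OF that(6)]
    by (simp add: power2_eq_square ac_simps)
  show ?thesis
    unfolding F1 unfolding p1_def[symmetric] p2_def[symmetric] N_def[symmetric]
    unfolding yy form_expand_step[OF sP c(1-5)]
    by (rule arith[OF b2 b3 b4 b5 b6 b7])
qed

section \<open>Inverses and data matrices\<close>

text \<open>Definiteness excludes a kernel vector, so the determinant is nonzero and
  \<open>mat_inverse\<close> succeeds; only then does \<open>minv\<close> have a specified value.
  Definiteness passes to the inverse R by writing v = P (R v).\<close>

lemma pos_def_minv:
  assumes P: "pos_def n P"
  shows "P * minv P = 1\<^sub>m n" "minv P * P = 1\<^sub>m n" "pos_def n (minv P)"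
proof -
  have Pc: "P \<in> carrier_mat n n" by (rule sym_matD[OF pos_defD(1)[OF P]])
  have "det P \<noteq> 0"
  proof
    assume "det P = 0"
    then obtain v where v: "v \<in> carrier_vec n" "v \<noteq> 0\<^sub>v n" "P *\<^sub>v v = 0\<^sub>v n"
      using det_0_iff_vec_prod_zero[OF Pc] by blast
    with pos_defD(2)[OF P v(1,2)] show False by simp
  qed
  then have "P \<in> Units (ring_mat TYPE(real) n ())"
    by (rule det_non_zero_imp_unit[OF Pc])
  then obtain R where R: "mat_inverse P = Some R"
    using mat_inverse(1)[OF Pc, of "()"] by (cases "mat_inverse P") auto
  then have mR: "minv P = R" by (simp add: minv_def)
  show inv: "P * minv P = 1\<^sub>m n" "minv P * P = 1\<^sub>m n"
    using mat_inverse(2)[OF Pc R] by (auto simp: mR)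
  have Rc: "R \<in> carrier_mat n n" using mat_inverse(2)[OF Pc R] by simp
  have PR: "P *\<^sub>v (R *\<^sub>v v) = v" if "v \<in> carrier_vec n" for v
    using assoc_mult_mat_vec[OF Pc Rc that] inv that by (simp add: mR)
  have RP: "R *\<^sub>v (P *\<^sub>v v) = v" if "v \<in> carrier_vec n" for v
    using assoc_mult_mat_vec[OF Rc Pc that] inv that by (simp add: mR)
  have PT: "transpose_mat P = P" using P by (simp add: pos_def_def sym_mat_def)
  have "P * transpose_mat R = 1\<^sub>m n"
    using transpose_mult[OF Rc Pc] inv(2) by (simp add: mR PT)
  \<comment> \<open>The product R P R^T is R when bracketed to the right and R^T when bracketed to
    the left.\<close>
  then have "R * (P * transpose_mat R) = R" using Rc by simp
  then have "transpose_mat R = R"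
    using assoc_mult_mat[OF Rc Pc transpose_carrier_mat[THEN iffD2, OF Rc]] inv(2) Rc
    by (simp add: mR)
  moreover have "0 < v \<bullet> (R *\<^sub>v v)" if v: "v \<in> carrier_vec n" "v \<noteq> 0\<^sub>v n" for v
  proof -
    have Rv: "R *\<^sub>v v \<in> carrier_vec n" using Rc v by simp
    have "R *\<^sub>v v \<noteq> 0\<^sub>v n" using PR[OF v(1)] mat_mult_zero_vec[OF Pc] v(2) by metis
    from pos_defD(2)[OF P Rv this] show ?thesis
      using comm_scalar_prod[OF Rv v(1)] by (simp add: PR[OF v(1)])
  qed
  ultimately show "pos_def n (minv P)" using Rc by (simp add: pos_def_def sym_mat_def mR)
qed

lemma append_cols_mult_vec:
  assumes "M \<in> carrier_mat r c" "N \<in> carrier_mat r k" "a \<in> carrier_vec c" "b \<in> carrier_vec k"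
  shows "append_cols M N *\<^sub>v (a @\<^sub>v b) = M *\<^sub>v a + N *\<^sub>v b"
  unfolding append_cols_def
  using assms four_block_mat_mult_vec[of M r c N k "0\<^sub>m 0 c" 0 "0\<^sub>m 0 k" a b]
  by (auto intro!: eq_vecI)

lemma data_mat_carrier [simp]: "data_mat r T f \<in> carrier_mat r T"
  by (simp add: data_mat_def mat_of_cols_def)

lemma col_data_mat: "j < T \<Longrightarrow> f j \<in> carrier_vec r \<Longrightarrow> col (data_mat r T f) j = f j"
  by (simp add: data_mat_def)

text \<open>Each of the T coordinates of the image is the product of one sample with z, hence at
  most \<delta> |z| in absolute value. This is the origin of the factor sqrt T in
  \<open>\<Delta>\<close>.\<close>

lemma vnorm_transpose_data_mat_le:
  assumes f: "\<And>k. k < T \<Longrightarrow> f k \<in> carrier_vec r" "\<And>k. k < T \<Longrightarrow> vnorm (f k) \<le> \<delta>"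
    and "0 \<le> \<delta>" and z: "z \<in> carrier_vec r"
  shows "vnorm (transpose_mat (data_mat r T f) *\<^sub>v z) \<le> (\<delta> * sqrt (real T)) * vnorm z"
proof -
  have "\<bar>(transpose_mat (data_mat r T f) *\<^sub>v z) $ k\<bar> \<le> \<delta> * vnorm z" if k: "k < T" for k
  proof -
    have "(transpose_mat (data_mat r T f) *\<^sub>v z) $ k = f k \<bullet> z"
      using k f(1)[OF k] carrier_matD[OF data_mat_carrier[of r T f]] by (simp add: col_data_mat)
    also have "\<bar>f k \<bullet> z\<bar> \<le> vnorm (f k) * vnorm z" by (rule abs_scalar_prod_le[OF f(1)[OF k] z])
    also have "\<dots> \<le> \<delta> * vnorm z" by (intro mult_right_mono f(2)[OF k]) simp
    finally show ?thesis .
  qed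
  then have "(\<Sum>k<T. ((transpose_mat (data_mat r T f) *\<^sub>v z) $ k)\<^sup>2) \<le> (\<Sum>k<T. (\<delta> * vnorm z)\<^sup>2)"
    by (intro sum_mono) (auto simp: abs_le_square_iff[symmetric] abs_mult \<open>0 \<le> \<delta>\<close>)
  then have "vnorm (transpose_mat (data_mat r T f) *\<^sub>v z) \<le> sqrt (\<Sum>k<T. (\<delta> * vnorm z)\<^sup>2)"
    using carrier_matD[OF data_mat_carrier[of r T f]] by (simp add: vnorm_eq_L2_set L2_set_def atLeast0LessThan)
  also have "\<dots> = (\<delta> * sqrt (real T)) * vnorm z"
    using \<open>0 \<le> \<delta>\<close> by (simp add: real_sqrt_mult abs_mult)
  finally show ?thesis .
qed

text \<open>From |D v|^2 = (D^T D v)^T v \<le> \<beta> |D v| |v| one factor |D v| cancels.\<close>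

lemma vnorm_mult_le_of_transpose:
  assumes D: "D \<in> carrier_mat r c" and "0 \<le> \<beta>"
    and bound: "\<And>z. z \<in> carrier_vec r \<Longrightarrow> vnorm (transpose_mat D *\<^sub>v z) \<le> \<beta> * vnorm z"
    and v: "v \<in> carrier_vec c"
  shows "vnorm (D *\<^sub>v v) \<le> \<beta> * vnorm v"
proof (cases "vnorm (D *\<^sub>v v) = 0")
  case True
  then show ?thesis using \<open>0 \<le> \<beta>\<close> by simp
next
  case False
  have Dv: "D *\<^sub>v v \<in> carrier_vec r" using D v by simp
  have "vnorm (D *\<^sub>v v) * vnorm (D *\<^sub>v v) = (transpose_mat D *\<^sub>v (D *\<^sub>v v)) \<bullet> v"
    using vnorm_square[of "D *\<^sub>v v"] transpose_vec_mult_scalar[OF D v Dv]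
    by (simp add: power2_eq_square)
  also have "\<dots> \<le> vnorm (transpose_mat D *\<^sub>v (D *\<^sub>v v)) * vnorm v"
    using abs_scalar_prod_le[of "transpose_mat D *\<^sub>v (D *\<^sub>v v)" c v] D v Dv by auto
  also have "\<dots> \<le> (\<beta> * vnorm (D *\<^sub>v v)) * vnorm v"
    by (intro mult_right_mono bound Dv) simp
  finally have "vnorm (D *\<^sub>v v) * vnorm (D *\<^sub>v v) \<le> vnorm (D *\<^sub>v v) * (\<beta> * vnorm v)"
    by (simp add: ac_simps)
  then show ?thesis using False by (simp add: order_less_le)
qed

section \<open>The linear matrix inequality\<close>

text \<open>Each nonzero off-diagonal block meets its transpose, which gives the factors 2. The
  product with \<open>\<Delta>\<close> stays an opaque matrix \<open>S\<close>, of which only the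
  dimension matters here.\<close>

lemma lmi_form:
  assumes c: "P1 \<in> carrier_mat n n" "\<Omega> \<in> carrier_mat n n" "X1 \<in> carrier_mat n T"
    "Y1 \<in> carrier_mat T n" "S \<in> carrier_mat n n" "a \<in> carrier_vec n" "b \<in> carrier_vec n" "v \<in> carrier_vec T"
    and S: "S = E * \<Delta> * transpose_mat \<Delta> * transpose_mat E"
  shows "((a @\<^sub>v b) @\<^sub>v v) \<bullet> (lmi_mat n T X1 E \<Delta> \<Omega> P1 Y1 \<epsilon> *\<^sub>v ((a @\<^sub>v b) @\<^sub>v v)) =
     a \<bullet> (P1 *\<^sub>v a) - a \<bullet> (\<Omega> *\<^sub>v a) + 2 * (b \<bullet> (X1 *\<^sub>v (Y1 *\<^sub>v a))) + 2 * (v \<bullet> (Y1 *\<^sub>v a))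
     + b \<bullet> (P1 *\<^sub>v b) - \<epsilon> * (b \<bullet> (S *\<^sub>v b)) + \<epsilon> * (v \<bullet> v)"
proof -
  have XY: "X1 * Y1 \<in> carrier_mat n n" using c by simp
  have PO: "P1 - \<Omega> \<in> carrier_mat n n" by (rule minus_carrier_mat[OF c(2)])
  have PS: "P1 - \<epsilon> \<cdot>\<^sub>m S \<in> carrier_mat n n" using c by (intro minus_carrier_mat) simp
  have YT: "transpose_mat Y1 \<in> carrier_mat n T" using c by simp
  have XYT: "transpose_mat (X1 * Y1) \<in> carrier_mat n n" using XY by simp
  have M11: "four_block_mat (P1 - \<Omega>) (transpose_mat (X1 * Y1)) (X1 * Y1) (P1 - \<epsilon> \<cdot>\<^sub>m S)
      \<in> carrier_mat (n + n) (n + n)" by (rule four_block_carrier_mat[OF PO PS])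
  have M12: "transpose_mat Y1 @\<^sub>r 0\<^sub>m n T \<in> carrier_mat (n + n) T" using YT by simp
  have M21: "append_cols Y1 (0\<^sub>m T n) \<in> carrier_mat T (n + n)"
    using c unfolding append_cols_def by (metis add_0_right carrier_matD(2) four_block_carrier_mat index_zero_mat(3) zero_carrier_mat)
  have ab: "a @\<^sub>v b \<in> carrier_vec (n + n)" using c by simp
  have m12: "(transpose_mat Y1 @\<^sub>r 0\<^sub>m n T) *\<^sub>v v = (transpose_mat Y1 *\<^sub>v v) @\<^sub>v 0\<^sub>v n"
    using mat_mult_append[OF YT zero_carrier_mat c(8), of n] c by (simp add: zero_mat_mult_vec)
  have m21: "append_cols Y1 (0\<^sub>m T n) *\<^sub>v (a @\<^sub>v b) = Y1 *\<^sub>v a"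
    using append_cols_mult_vec[OF c(4) zero_carrier_mat c(6,7)] c by (simp add: zero_mat_mult_vec)
  have m22: "(\<epsilon> \<cdot>\<^sub>m 1\<^sub>m T) *\<^sub>v v = \<epsilon> \<cdot>\<^sub>v v" using c by (intro eq_vecI) auto
  define p where "p = (P1 - \<Omega>) *\<^sub>v a + transpose_mat (X1 * Y1) *\<^sub>v b"
  define q where "q = (X1 * Y1) *\<^sub>v a + (P1 - \<epsilon> \<cdot>\<^sub>m S) *\<^sub>v b"
  have pq: "p \<in> carrier_vec n" "q \<in> carrier_vec n"
    unfolding p_def q_def
    by (intro add_carrier_vec mult_mat_vec_carrier[OF PO c(6)] mult_mat_vec_carrier[OF XYT c(7)]
        mult_mat_vec_carrier[OF XY c(6)] mult_mat_vec_carrier[OF PS c(7)])+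
  have "lmi_mat n T X1 E \<Delta> \<Omega> P1 Y1 \<epsilon> *\<^sub>v ((a @\<^sub>v b) @\<^sub>v v) =
      ((p @\<^sub>v q) + ((transpose_mat Y1 *\<^sub>v v) @\<^sub>v 0\<^sub>v n)) @\<^sub>v (Y1 *\<^sub>v a + \<epsilon> \<cdot>\<^sub>v v)"
    unfolding lmi_mat_def S[symmetric] p_def q_def
    using four_block_mat_mult_vec[where D = "\<epsilon> \<cdot>\<^sub>m 1\<^sub>m T", OF M11 M12 M21 smult_carrier_mat[OF one_carrier_mat] ab c(8)]
    unfolding four_block_mat_mult_vec[OF PO XYT XY PS c(6,7)] m12 m21 m22 .
  also have "(p @\<^sub>v q) + ((transpose_mat Y1 *\<^sub>v v) @\<^sub>v 0\<^sub>v n) = (p + transpose_mat Y1 *\<^sub>v v) @\<^sub>v q"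
    unfolding append_vec_add[OF pq(1) mult_mat_vec_carrier[OF YT c(8)] pq(2) zero_carrier_vec]
    using pq by simp
  finally have Mv: "lmi_mat n T X1 E \<Delta> \<Omega> P1 Y1 \<epsilon> *\<^sub>v ((a @\<^sub>v b) @\<^sub>v v) =
      ((p + transpose_mat Y1 *\<^sub>v v) @\<^sub>v q) @\<^sub>v (Y1 *\<^sub>v a + \<epsilon> \<cdot>\<^sub>v v)" .
  have "((a @\<^sub>v b) @\<^sub>v v) \<bullet> (((p + transpose_mat Y1 *\<^sub>v v) @\<^sub>v q) @\<^sub>v (Y1 *\<^sub>v a + \<epsilon> \<cdot>\<^sub>v v))
      = (a @\<^sub>v b) \<bullet> ((p + transpose_mat Y1 *\<^sub>v v) @\<^sub>v q) + v \<bullet> (Y1 *\<^sub>v a + \<epsilon> \<cdot>\<^sub>v v)"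
    using pq YT c by (intro scalar_prod_append[of _ "n + n" _ T]) auto
  also have "(a @\<^sub>v b) \<bullet> ((p + transpose_mat Y1 *\<^sub>v v) @\<^sub>v q) = a \<bullet> (p + transpose_mat Y1 *\<^sub>v v) + b \<bullet> q"
    using pq YT c by (intro scalar_prod_append[of _ n _ n]) auto
  also have "a \<bullet> (p + transpose_mat Y1 *\<^sub>v v) = a \<bullet> p + a \<bullet> (transpose_mat Y1 *\<^sub>v v)"
    using pq YT c by (intro scalar_prod_add_distrib[of _ n]) auto
  also have "a \<bullet> p = a \<bullet> (P1 *\<^sub>v a - \<Omega> *\<^sub>v a) + a \<bullet> (transpose_mat (X1 * Y1) *\<^sub>v b)"
    unfolding p_def minus_mult_distrib_mat_vec[OF c(1,2,6)]
    using c by (intro scalar_prod_add_distrib[of _ n] mult_mat_vec_carrier[OF XYT]) auto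
  also have "a \<bullet> (P1 *\<^sub>v a - \<Omega> *\<^sub>v a) = a \<bullet> (P1 *\<^sub>v a) - a \<bullet> (\<Omega> *\<^sub>v a)"
    using c by (intro scalar_prod_minus_distrib[of _ n]) auto
  also have "a \<bullet> (transpose_mat (X1 * Y1) *\<^sub>v b) = b \<bullet> (X1 *\<^sub>v (Y1 *\<^sub>v a))"
    using transpose_vec_mult_scalar[OF XY c(6,7)]
    unfolding assoc_mult_mat_vec[OF c(3,4,6)] comm_scalar_prod[OF c(6) mult_mat_vec_carrier[OF XYT c(7)]] .
  also have "a \<bullet> (transpose_mat Y1 *\<^sub>v v) = v \<bullet> (Y1 *\<^sub>v a)"
    using transpose_vec_mult_scalar[OF c(4,6,8)] comm_scalar_prod[of a n "transpose_mat Y1 *\<^sub>v v"] c YT by simp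
  also have "b \<bullet> q = b \<bullet> (X1 *\<^sub>v (Y1 *\<^sub>v a)) + b \<bullet> ((P1 - \<epsilon> \<cdot>\<^sub>m S) *\<^sub>v b)"
    unfolding q_def assoc_mult_mat_vec[OF c(3,4,6)]
    using c PS by (intro scalar_prod_add_distrib[of _ n]) auto
  also have "(P1 - \<epsilon> \<cdot>\<^sub>m S) *\<^sub>v b = P1 *\<^sub>v b - \<epsilon> \<cdot>\<^sub>v (S *\<^sub>v b)"
    using minus_mult_distrib_mat_vec[OF c(1) _ c(7), of "\<epsilon> \<cdot>\<^sub>m S"] smult_mat_mult_vec[OF c(5,7)] c by simp
  also have "b \<bullet> (P1 *\<^sub>v b - \<epsilon> \<cdot>\<^sub>v (S *\<^sub>v b)) = b \<bullet> (P1 *\<^sub>v b) - b \<bullet> (\<epsilon> \<cdot>\<^sub>v (S *\<^sub>v b))"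
    using c by (intro scalar_prod_minus_distrib[of _ n]) auto
  also have "b \<bullet> (\<epsilon> \<cdot>\<^sub>v (S *\<^sub>v b)) = \<epsilon> * (b \<bullet> (S *\<^sub>v b))"
    using c by (intro scalar_prod_smult_distrib[of _ n]) auto
  also have "v \<bullet> (Y1 *\<^sub>v a + \<epsilon> \<cdot>\<^sub>v v) = v \<bullet> (Y1 *\<^sub>v a) + v \<bullet> (\<epsilon> \<cdot>\<^sub>v v)"
    using c by (intro scalar_prod_add_distrib[of _ T]) auto
  also have "v \<bullet> (\<epsilon> \<cdot>\<^sub>v v) = \<epsilon> * (v \<bullet> v)"
    using c by (intro scalar_prod_smult_distrib[of _ T]) auto
  finally show ?thesis unfolding Mv by simp
qed

text \<open>Testing the matrix inequality on \<open>(a, b, - D\<^sup>T E\<^sup>T b)\<close> replaces the data matrix \<open>X1\<close> by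
  the true one \<open>X1 - E D\<close>; the block \<open>- \<epsilon> E \<Delta> \<Delta>\<^sup>T E\<^sup>T\<close> pays for the square of the last component.\<close>

lemma lmi_robust:
  assumes lmi: "pos_def (n + n + T) (lmi_mat n T X1 E \<Delta> \<Omega> P1 Y1 \<epsilon>)"
    and c: "P1 \<in> carrier_mat n n" "\<Omega> \<in> carrier_mat n n" "X1 \<in> carrier_mat n T"
      "Y1 \<in> carrier_mat T n" "E \<in> carrier_mat n s" "D \<in> carrier_mat s T"
    and \<Delta>: "\<Delta> = \<beta> \<cdot>\<^sub>m 1\<^sub>m s" and eps: "0 < \<epsilon>"
    and bound: "\<And>z. z \<in> carrier_vec s \<Longrightarrow> vnorm (transpose_mat D *\<^sub>v z) \<le> \<beta> * vnorm z"
    and ab: "a \<in> carrier_vec n" "b \<in> carrier_vec n"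
  shows "0 \<le> a \<bullet> (P1 *\<^sub>v a) - a \<bullet> (\<Omega> *\<^sub>v a) + 2 * (b \<bullet> ((X1 - E * D) *\<^sub>v (Y1 *\<^sub>v a))) + b \<bullet> (P1 *\<^sub>v b)"
proof -
  define z where "z = transpose_mat E *\<^sub>v b"
  define v where "v = - (transpose_mat D *\<^sub>v z)"
  have z: "z \<in> carrier_vec s" and v: "v \<in> carrier_vec T" using c ab by (auto simp: z_def v_def)
  define S where "S = E * \<Delta> * transpose_mat \<Delta> * transpose_mat E"
  have Sc: "S \<in> carrier_mat n n" using c by (auto simp: S_def \<Delta> intro!: mult_carrier_mat[of _ n s])
  have Dz: "transpose_mat D *\<^sub>v z \<in> carrier_vec T" using c z by simp
  have ET: "transpose_mat E \<in> carrier_mat s n" using c by simp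
  have SE: "S = \<beta>\<^sup>2 \<cdot>\<^sub>m (E * transpose_mat E)"
  proof -
    have "E * \<Delta> = \<beta> \<cdot>\<^sub>m E" "transpose_mat \<Delta> = \<Delta>" using c by (auto simp: \<Delta> intro!: eq_matI)
    moreover have "\<beta> \<cdot>\<^sub>m E * \<Delta> = \<beta>\<^sup>2 \<cdot>\<^sub>m E"
      using c by (auto simp: \<Delta> power2_eq_square intro!: eq_matI)
    ultimately show ?thesis using mult_smult_assoc_mat[OF c(5) ET] by (simp add: S_def)
  qed
  have "S *\<^sub>v b = \<beta>\<^sup>2 \<cdot>\<^sub>v (E *\<^sub>v z)"
  proof -
    have "(\<beta>\<^sup>2 \<cdot>\<^sub>m (E * transpose_mat E)) *\<^sub>v b = \<beta>\<^sup>2 \<cdot>\<^sub>v ((E * transpose_mat E) *\<^sub>v b)"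
      using c ab by (intro smult_mat_mult_vec[of _ n n]) auto
    then show ?thesis
      using SE assoc_mult_mat_vec[OF c(5) ET ab(2)] by (simp add: z_def)
  qed
  then have "b \<bullet> (S *\<^sub>v b) = \<beta>\<^sup>2 * (b \<bullet> (E *\<^sub>v z))"
    using c ab z by (simp add: scalar_prod_smult_distrib[of b n])
  also have "b \<bullet> (E *\<^sub>v z) = z \<bullet> z"
    using transpose_vec_mult_scalar[OF c(5) z ab(2)] by (simp add: z_def)
  finally have bS: "b \<bullet> (S *\<^sub>v b) = (\<beta> * vnorm z)\<^sup>2"
    by (simp add: vnorm_square[symmetric] power_mult_distrib)
  \<comment> \<open>The comparison of D D^T with \<Delta> \<Delta>^T, evaluated at z = E^T b. It
    makes the two terms of \<open>lmi_form\<close> that carry \<open>\<epsilon>\<close> nonpositive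
    together, so dropping them preserves the inequality.\<close>
  have "v \<bullet> v = (transpose_mat D *\<^sub>v z) \<bullet> (transpose_mat D *\<^sub>v z)"
    using Dz by (simp add: v_def)
  also have "\<dots> = (vnorm (transpose_mat D *\<^sub>v z))\<^sup>2" by (simp add: vnorm_square)
  also have "\<dots> \<le> (\<beta> * vnorm z)\<^sup>2" by (intro power_mono bound z) simp
  finally have vv: "\<epsilon> * (v \<bullet> v) \<le> \<epsilon> * (b \<bullet> (S *\<^sub>v b))" using eps bS by simp
  have Ya: "Y1 *\<^sub>v a \<in> carrier_vec T" using c ab by simp
  have DYa: "D *\<^sub>v (Y1 *\<^sub>v a) \<in> carrier_vec s" using c Ya by simp
  have "v \<bullet> (Y1 *\<^sub>v a) = - ((transpose_mat D *\<^sub>v z) \<bullet> (Y1 *\<^sub>v a))"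
    unfolding v_def using carrier_vecD[OF Dz] carrier_vecD[OF Ya] by (intro scalar_prod_uminus_left) simp
  also have "(transpose_mat D *\<^sub>v z) \<bullet> (Y1 *\<^sub>v a) = z \<bullet> (D *\<^sub>v (Y1 *\<^sub>v a))"
    by (rule transpose_vec_mult_scalar[OF c(6) Ya z])
  also have "\<dots> = b \<bullet> (E *\<^sub>v (D *\<^sub>v (Y1 *\<^sub>v a)))"
    unfolding z_def by (rule transpose_vec_mult_scalar[OF c(5) DYa ab(2)])
  finally have vY: "v \<bullet> (Y1 *\<^sub>v a) = - (b \<bullet> (E *\<^sub>v (D *\<^sub>v (Y1 *\<^sub>v a))))" .
  have ED: "E * D \<in> carrier_mat n T" using c by simp
  have "b \<bullet> ((X1 - E * D) *\<^sub>v (Y1 *\<^sub>v a))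
      = b \<bullet> (X1 *\<^sub>v (Y1 *\<^sub>v a)) - b \<bullet> (E *\<^sub>v (D *\<^sub>v (Y1 *\<^sub>v a)))"
    unfolding minus_mult_distrib_mat_vec[OF c(3) ED Ya] assoc_mult_mat_vec[OF c(5,6) Ya]
    using c ab Ya DYa by (intro scalar_prod_minus_distrib[of _ n]) auto
  moreover have "0 \<le> ((a @\<^sub>v b) @\<^sub>v v) \<bullet> (lmi_mat n T X1 E \<Delta> \<Omega> P1 Y1 \<epsilon> *\<^sub>v ((a @\<^sub>v b) @\<^sub>v v))"
    using ab v by (intro pos_def_nonneg[OF lmi]) simp
  ultimately show ?thesis
    using vv vY unfolding lmi_form[OF c(1-4) Sc ab v S_def] by simp
qed

text \<open>For b = 0 the inequality says that \<open>P1\<close> dominates \<open>\<Omega>\<close>.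
  This has to come before any use of \<open>minv P1\<close>, since \<open>sdp_feasible\<close>
  itself only asks \<open>P1\<close> to be symmetric.\<close>

lemma lmi_pos_def:
  assumes lmi: "\<And>a b. a \<in> carrier_vec n \<Longrightarrow> b \<in> carrier_vec n \<Longrightarrow>
      0 \<le> a \<bullet> (P1 *\<^sub>v a) - a \<bullet> (\<Omega> *\<^sub>v a) + 2 * (b \<bullet> (F *\<^sub>v (Y1 *\<^sub>v a))) + b \<bullet> (P1 *\<^sub>v b)"
    and P1: "sym_mat n P1" and \<Omega>: "pos_def n \<Omega>" and F: "F \<in> carrier_mat n T" and Y1: "Y1 \<in> carrier_mat T n"
  shows "pos_def n P1"
proof -
  have "0 < a \<bullet> (P1 *\<^sub>v a)" if a: "a \<in> carrier_vec n" "a \<noteq> 0\<^sub>v n" for a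
  proof -
    have "F *\<^sub>v (Y1 *\<^sub>v a) \<in> carrier_vec n" using F Y1 a by simp
    moreover have "0\<^sub>v n \<bullet> (P1 *\<^sub>v 0\<^sub>v n) = 0" using sym_matD[OF P1] by (simp add: mat_mult_zero_vec[of _ n n])
    ultimately show ?thesis
      using lmi[OF a(1), of "0\<^sub>v n"] pos_defD(2)[OF \<Omega> a] by simp
  qed
  with P1 show ?thesis by (simp add: pos_def_def)
qed

text \<open>The choice \<open>a = P1\<^sup>-\<^sup>1 x\<close>, \<open>b = - P1\<^sup>-\<^sup>1 F Y1 a\<close> is the Schur complement in the block of \<open>b\<close>.\<close>

lemma lmi_decrease:
  assumes lmi: "\<And>a b. a \<in> carrier_vec n \<Longrightarrow> b \<in> carrier_vec n \<Longrightarrow>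
      0 \<le> a \<bullet> (P1 *\<^sub>v a) - a \<bullet> (\<Omega> *\<^sub>v a) + 2 * (b \<bullet> (F *\<^sub>v (Y1 *\<^sub>v a))) + b \<bullet> (P1 *\<^sub>v b)"
    and P1: "pos_def n P1" and \<Omega>: "\<Omega> \<in> carrier_mat n n" and F: "F \<in> carrier_mat n T" and Y1: "Y1 \<in> carrier_mat T n"
    and x: "x \<in> carrier_vec n" and y: "y = F *\<^sub>v ((Y1 * minv P1) *\<^sub>v x)"
  shows "y \<bullet> (minv P1 *\<^sub>v y) \<le> x \<bullet> (minv P1 *\<^sub>v x) - x \<bullet> ((minv P1 * \<Omega> * minv P1) *\<^sub>v x)"
proof -
  define R where "R = minv P1"
  have R: "sym_mat n R" using pos_defD(1)[OF pos_def_minv(3)[OF P1]] by (simp add: R_def)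
  have Rc: "R \<in> carrier_mat n n" by (rule sym_matD[OF R])
  have RT: "transpose_mat R = R" using R by (simp add: sym_mat_def)
  have P1c: "P1 \<in> carrier_mat n n" by (rule sym_matD[OF pos_defD(1)[OF P1]])
  have PR: "P1 *\<^sub>v (R *\<^sub>v u) = u" if "u \<in> carrier_vec n" for u
    using assoc_mult_mat_vec[OF P1c Rc that] pos_def_minv(1)[OF P1] that by (simp add: R_def)
  define a where "a = R *\<^sub>v x"
  have a: "a \<in> carrier_vec n" using Rc x by (simp add: a_def)
  have ya: "y = F *\<^sub>v (Y1 *\<^sub>v a)"
    using assoc_mult_mat_vec[OF Y1 Rc x] by (simp add: y a_def R_def)
  have yc: "y \<in> carrier_vec n" using F Y1 a by (simp add: ya)
  have Ry: "R *\<^sub>v y \<in> carrier_vec n" using Rc yc by simp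
  \<comment> \<open>This \<open>b\<close> minimises the right-hand side for fixed \<open>a\<close>:
    its two terms add up to \<open>- (y \<bullet> (R *\<^sub>v y))\<close>, the negative of the
    value to be bounded.\<close>
  have "0 \<le> a \<bullet> (P1 *\<^sub>v a) - a \<bullet> (\<Omega> *\<^sub>v a) + 2 * ((- (R *\<^sub>v y)) \<bullet> y) + (- (R *\<^sub>v y)) \<bullet> (P1 *\<^sub>v (- (R *\<^sub>v y)))"
    using lmi[OF a, of "- (R *\<^sub>v y)"] Ry by (simp add: ya)
  also have "(- (R *\<^sub>v y)) \<bullet> (P1 *\<^sub>v (- (R *\<^sub>v y))) = (R *\<^sub>v y) \<bullet> y"
    using form_linear(4)[OF P1c Ry Ry, of "- (R *\<^sub>v y)" "- (R *\<^sub>v y)"]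
      form_linear(8)[OF P1c Ry Ry Ry Ry] Ry PR[OF yc] by simp
  also have "(- (R *\<^sub>v y)) \<bullet> y = - ((R *\<^sub>v y) \<bullet> y)" using Rc Ry yc by simp
  also have "(R *\<^sub>v y) \<bullet> y = y \<bullet> (R *\<^sub>v y)" by (rule comm_scalar_prod[OF Ry yc])
  also have "a \<bullet> (P1 *\<^sub>v a) = x \<bullet> (R *\<^sub>v x)"
    using PR[OF x] comm_scalar_prod[OF a x] by (simp add: a_def)
  also have "a \<bullet> (\<Omega> *\<^sub>v a) = x \<bullet> ((R * \<Omega> * R) *\<^sub>v x)"
  proof -
    have "a \<bullet> (\<Omega> *\<^sub>v a) = x \<bullet> (R *\<^sub>v (\<Omega> *\<^sub>v a))"
      using transpose_vec_mult_scalar[OF Rc _ x, of "\<Omega> *\<^sub>v a"] \<Omega> a by (simp add: RT a_def)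
    then show ?thesis using transpose_mult_mult_vec[OF \<Omega> Rc x] by (simp add: RT a_def)
  qed
  finally show ?thesis by (simp add: R_def)
qed

section \<open>The closed loop\<close>

lemma data_identity:
  assumes c: "A \<in> carrier_mat n S" "B \<in> carrier_mat n m" "E \<in> carrier_mat n s"
    and z: "\<And>k. k < T \<Longrightarrow> z k \<in> carrier_vec S" and u: "\<And>k. k < T \<Longrightarrow> u k \<in> carrier_vec m"
    and d: "\<And>k. k < T \<Longrightarrow> d k \<in> carrier_vec s"
    and y: "\<And>k. k < T \<Longrightarrow> y k = A *\<^sub>v z k + B *\<^sub>v u k + E *\<^sub>v d k"
  shows "data_mat n T y - E * data_mat s T d = A * data_mat S T z + B * data_mat m T u"
proof (intro eq_matI)
  note dims = carrier_matD[OF data_mat_carrier[of _ T _]]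
  fix i j assume "i < dim_row (A * data_mat S T z + B * data_mat m T u)"
    and "j < dim_col (A * data_mat S T z + B * data_mat m T u)"
  then have i: "i < n" and j: "j < T" using c by (auto simp: dims)
  have "data_mat n T y $$ (i, j) = y j $ i"
    using i j by (simp add: data_mat_def mat_of_cols_index)
  then show "(data_mat n T y - E * data_mat s T d) $$ (i, j)
      = (A * data_mat S T z + B * data_mat m T u) $$ (i, j)"
    using i j c by (simp add: dims col_data_mat z u d y)
qed (use c in \<open>simp_all add: carrier_matD[OF data_mat_carrier[of _ T _]]\<close>)

lemma closed_loop_data:
  assumes c: "A \<in> carrier_mat n (n + q)" "B \<in> carrier_mat n m" "U0 \<in> carrier_mat m T" "Z0 \<in> carrier_mat (n + q) T"
    "Y1 \<in> carrier_mat T n" "G2 \<in> carrier_mat T q" "R \<in> carrier_mat n n" "P1 \<in> carrier_mat n n"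
    and inv: "P1 * R = 1\<^sub>m n"
    and Z: "Z0 * Y1 = P1 @\<^sub>r 0\<^sub>m q n" "Z0 * G2 = 0\<^sub>m n q @\<^sub>r 1\<^sub>m q"
    and x: "x \<in> carrier_vec n" "Q x \<in> carrier_vec q"
  shows "closed_loop A B E (U0 * append_cols (Y1 * R) G2) Q x d
     = (A * Z0 + B * U0) *\<^sub>v ((Y1 * R) *\<^sub>v x + G2 *\<^sub>v Q x) + E *\<^sub>v d"
proof -
  have YR: "Y1 * R \<in> carrier_mat T n" using c by simp
  \<comment> \<open>\<open>h\<close> holds the weights that write Z(x) as a combination of the
    recorded samples. The gain applies the same weights to the recorded inputs, so the unknown
    \<open>A\<close> and \<open>B\<close> occur only through \<open>A * Z0 + B * U0\<close>.\<close>
  define h where "h = (Y1 * R) *\<^sub>v x + G2 *\<^sub>v Q x"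
  have h: "h \<in> carrier_vec T" using YR c x by (simp add: h_def)
  have Rx: "R *\<^sub>v x \<in> carrier_vec n" using c x by simp
  have "Z0 *\<^sub>v ((Y1 * R) *\<^sub>v x) = (Z0 * Y1) *\<^sub>v (R *\<^sub>v x)"
    unfolding assoc_mult_mat_vec[OF c(5,7) x(1)] assoc_mult_mat_vec[OF c(4,5) Rx] ..
  also have "\<dots> = (P1 *\<^sub>v (R *\<^sub>v x)) @\<^sub>v (0\<^sub>m q n *\<^sub>v (R *\<^sub>v x))"
    unfolding Z by (rule mat_mult_append[OF c(8) zero_carrier_mat Rx])
  also have "P1 *\<^sub>v (R *\<^sub>v x) = x"
    using assoc_mult_mat_vec[OF c(8,7) x(1)] inv x by simp
  also have "0\<^sub>m q n *\<^sub>v (R *\<^sub>v x) = 0\<^sub>v q" by (rule zero_mat_mult_vec[OF Rx])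
  finally have Z1: "Z0 *\<^sub>v ((Y1 * R) *\<^sub>v x) = x @\<^sub>v 0\<^sub>v q" .
  have "Z0 *\<^sub>v (G2 *\<^sub>v Q x) = (Z0 * G2) *\<^sub>v Q x"
    by (rule assoc_mult_mat_vec[OF c(4,6) x(2), symmetric])
  also have "\<dots> = (0\<^sub>m n q *\<^sub>v Q x) @\<^sub>v (1\<^sub>m q *\<^sub>v Q x)"
    unfolding Z by (rule mat_mult_append[OF zero_carrier_mat one_carrier_mat x(2)])
  also have "0\<^sub>m n q *\<^sub>v Q x = 0\<^sub>v n" by (rule zero_mat_mult_vec[OF x(2)])
  finally have Z2: "Z0 *\<^sub>v (G2 *\<^sub>v Q x) = 0\<^sub>v n @\<^sub>v Q x" using x by simp
  have Zh: "Z0 *\<^sub>v h = Zmap Q x"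
  proof -
    have "Z0 *\<^sub>v h = (x @\<^sub>v 0\<^sub>v q) + (0\<^sub>v n @\<^sub>v Q x)"
      unfolding h_def Z1[symmetric] Z2[symmetric]
      using c YR x by (intro mult_add_distrib_mat_vec) auto
    also have "\<dots> = Zmap Q x"
      using append_vec_add[of x n "0\<^sub>v n" "0\<^sub>v q" q "Q x"] x by (simp add: Zmap_def)
    finally show ?thesis .
  qed
  have Kz: "(U0 * append_cols (Y1 * R) G2) *\<^sub>v Zmap Q x = U0 *\<^sub>v h"
  proof -
    have "append_cols (Y1 * R) G2 \<in> carrier_mat T (n + q)"
      using YR c unfolding append_cols_def
      by (metis add_0_right carrier_matD(2) four_block_carrier_mat zero_carrier_mat)
    then have "(U0 * append_cols (Y1 * R) G2) *\<^sub>v Zmap Q x = U0 *\<^sub>v (append_cols (Y1 * R) G2 *\<^sub>v Zmap Q x)"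
      using c x by (intro assoc_mult_mat_vec) (auto simp: Zmap_def)
    then show ?thesis
      using append_cols_mult_vec[OF YR c(6) x] by (simp add: Zmap_def h_def)
  qed
  have AZ: "A * Z0 \<in> carrier_mat n T" and BU: "B * U0 \<in> carrier_mat n T" using c by auto
  have "(A * Z0 + B * U0) *\<^sub>v h = A *\<^sub>v Zmap Q x + B *\<^sub>v (U0 *\<^sub>v h)"
    unfolding Zh[symmetric] assoc_mult_mat_vec[OF c(1,4) h, symmetric] assoc_mult_mat_vec[OF c(2,3) h, symmetric]
    by (rule add_mult_distrib_mat_vec[OF AZ BU h])
  then show ?thesis by (simp add: closed_loop_def Kz h_def)
qed

text \<open>With w1 = G1 x and w2 = G2 Q(x), the bound in \<open>form_step_bound\<close> matches
  \<ell> and g term by term, except for the form at the linear part; there \<open>decrease\<close>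
  supplies V(x) and the term with \<open>\<Omega>\<close>.\<close>

lemma lyap_step:
  assumes P1: "pos_def n P1" and E: "E \<in> carrier_mat n s" and X1: "X1 \<in> carrier_mat n T"
    and D: "D \<in> carrier_mat s T" and G: "G1 \<in> carrier_mat T n" "G2 \<in> carrier_mat T q"
    and bound: "\<And>v. v \<in> carrier_vec T \<Longrightarrow> vnorm (D *\<^sub>v v) \<le> norm2 \<Delta> * vnorm v"
    and x: "x \<in> carrier_vec n" "Q x \<in> carrier_vec q"
    and d: "d \<in> carrier_vec s" "vnorm d \<le> \<delta>"
    and decrease: "((X1 - E * D) *\<^sub>v (G1 *\<^sub>v x)) \<bullet> (minv P1 *\<^sub>v ((X1 - E * D) *\<^sub>v (G1 *\<^sub>v x)))
      \<le> x \<bullet> (minv P1 *\<^sub>v x) - x \<bullet> ((minv P1 * \<Omega> * minv P1) *\<^sub>v x)"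
    and y: "y = (X1 - E * D) *\<^sub>v (G1 *\<^sub>v x + G2 *\<^sub>v Q x) + E *\<^sub>v d"
  shows "lyap P1 y \<le> lyap P1 x + ell X1 E \<Delta> \<Omega> P1 G1 G2 Q x + gfun X1 E \<Delta> P1 G1 G2 Q x \<delta>"
proof -
  have w: "G1 *\<^sub>v x \<in> carrier_vec T" "G2 *\<^sub>v Q x \<in> carrier_vec T" using G x by auto
  show ?thesis
    using form_step_bound[OF pos_def_minv(3)[OF P1] E X1 D bound w d y] decrease
    unfolding lyap_def ell_def ell1_def ell2_def ell3_def ell4_def gfun_def r1_def r2_def r3_def
    by linarith
qed

section \<open>Positivity of \<ell> + g near the origin\<close>

text \<open>Only the \<open>\<Omega>\<close> term and \<open>ell1\<close> can lower the sum. Under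
  |Q(x)| \<le> |x| both are forms in vectors of length at most |x|, hence bounded by a multiple of
  |x|^2 with a constant independent of x.\<close>

lemma ell_gfun_lower:
  assumes P1: "pos_def n P1" and X1: "X1 \<in> carrier_mat n T" and G: "G1 \<in> carrier_mat T n" "G2 \<in> carrier_mat T q"
    and \<Omega>: "\<Omega> \<in> carrier_mat n n" and \<delta>: "0 \<le> \<delta>"
  shows "\<exists>C. \<forall>x\<in>carrier_vec n. Q x \<in> carrier_vec q \<longrightarrow> vnorm (Q x) \<le> vnorm x \<longrightarrow>
    r3 E P1 * \<delta>\<^sup>2 - C * (vnorm x)\<^sup>2 \<le> ell X1 E \<Delta> \<Omega> P1 G1 G2 Q x + gfun X1 E \<Delta> P1 G1 G2 Q x \<delta>"
proof -
  define R where "R = minv P1"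
  have R: "R \<in> carrier_mat n n" using pos_defD(1)[OF pos_def_minv(3)[OF P1]] by (simp add: R_def sym_mat_def)
  have mats: "2 \<cdot>\<^sub>m (X1 * G1) \<in> carrier_mat n n" "X1 * G2 \<in> carrier_mat n q" "R * \<Omega> * R \<in> carrier_mat n n"
    using X1 G R \<Omega> by auto
  let ?S = "2 \<cdot>\<^sub>m (X1 * G1)"
  \<comment> \<open>The summands bound the \<open>\<Omega>\<close> form, the part of
    \<open>ell1\<close> mixed in x and Q(x), and its part quadratic in Q(x); the last two are
    instances of \<open>form\<close>.\<close>
  define C where "C = norm2 (R * \<Omega> * R) + norm2 (transpose_mat ?S * R * (X1 * G2)) + norm2 (transpose_mat (X1 * G2) * R * (X1 * G2))"
  have form: "\<bar>(M *\<^sub>v u) \<bullet> (R *\<^sub>v (N *\<^sub>v v))\<bar> \<le> norm2 (transpose_mat M * R * N) * t\<^sup>2"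
    if "M \<in> carrier_mat n a" "N \<in> carrier_mat n b" "u \<in> carrier_vec a" "v \<in> carrier_vec b"
      "vnorm u \<le> t" "vnorm v \<le> t" for M N u v a b t
  proof -
    have MRN: "transpose_mat M * R * N \<in> carrier_mat a b" using that R by simp
    have Nv: "N *\<^sub>v v \<in> carrier_vec n" using that by simp
    have "(transpose_mat M * R * N) *\<^sub>v v = transpose_mat M *\<^sub>v (R *\<^sub>v (N *\<^sub>v v))"
      using assoc_mult_mat_vec[of "transpose_mat M * R" a n N b v] assoc_mult_mat_vec[of "transpose_mat M" a n R n "N *\<^sub>v v"]
        that R Nv by simp
    then have "(M *\<^sub>v u) \<bullet> (R *\<^sub>v (N *\<^sub>v v)) = u \<bullet> ((transpose_mat M * R * N) *\<^sub>v v)"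
      using transpose_vec_mult_scalar[of "transpose_mat M" a n "R *\<^sub>v (N *\<^sub>v v)" u] that R by simp
    also have "\<bar>\<dots>\<bar> \<le> vnorm u * vnorm ((transpose_mat M * R * N) *\<^sub>v v)"
      using MRN that by (intro abs_scalar_prod_le[of _ a]) auto
    also have "\<dots> \<le> t * (norm2 (transpose_mat M * R * N) * t)"
      using that order_trans[OF vnorm_nonneg that(5)]
      by (intro mult_mono order_trans[OF vnorm_mult_mat_vec_le[OF MRN]] mult_left_mono) auto
    finally show ?thesis by (simp add: power2_eq_square ac_simps)
  qed
  show ?thesis
  proof (intro exI ballI impI)
    fix x assume x: "x \<in> carrier_vec n" and Qx: "Q x \<in> carrier_vec q" and le: "vnorm (Q x) \<le> vnorm x"
    have Sx: "?S *\<^sub>v x = 2 \<cdot>\<^sub>v (X1 *\<^sub>v (G1 *\<^sub>v x))"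
      using smult_mat_mult_vec[of "X1 * G1" n n x 2] assoc_mult_mat_vec[OF X1 G(1) x] x X1 G by simp
    have SQ: "(X1 * G2) *\<^sub>v Q x = X1 *\<^sub>v (G2 *\<^sub>v Q x)" by (rule assoc_mult_mat_vec[OF X1 G(2) Qx])
    have "ell1 X1 P1 G1 G2 Q x
        = (?S *\<^sub>v x) \<bullet> (R *\<^sub>v ((X1 * G2) *\<^sub>v Q x)) + ((X1 * G2) *\<^sub>v Q x) \<bullet> (R *\<^sub>v ((X1 * G2) *\<^sub>v Q x))"
      unfolding ell1_def Sx[symmetric] SQ[symmetric] R_def[symmetric]
      using mats R x Qx by (intro add_scalar_prod_distrib[of _ n] mult_mat_vec_carrier[of _ n n] mult_mat_vec_carrier[of _ n q])
    moreover note abs_le_D2[OF form[OF mats(1,2) x Qx order_refl le]] abs_le_D2[OF form[OF mats(2,2) Qx Qx le le]]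
    moreover have "x \<bullet> ((R * \<Omega> * R) *\<^sub>v x) \<le> norm2 (R * \<Omega> * R) * (vnorm x)\<^sup>2"
    proof -
      have "x \<bullet> ((R * \<Omega> * R) *\<^sub>v x) \<le> vnorm x * vnorm ((R * \<Omega> * R) *\<^sub>v x)"
        using abs_scalar_prod_le[OF x, of "(R * \<Omega> * R) *\<^sub>v x"] mult_mat_vec_carrier[OF mats(3) x] by simp
      also have "\<dots> \<le> vnorm x * (norm2 (R * \<Omega> * R) * vnorm x)"
        by (intro mult_left_mono vnorm_mult_mat_vec_le[OF mats(3) x]) simp
      finally show ?thesis by (simp add: power2_eq_square ac_simps)
    qed
    moreover have "0 \<le> ell2 X1 E \<Delta> P1 G1 G2 Q x" "0 \<le> ell3 X1 E \<Delta> P1 G1 G2 Q x" "0 \<le> ell4 E \<Delta> P1 G1 G2 Q x"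
      "0 \<le> r1 X1 E P1 G1 G2 Q x * \<delta>" "0 \<le> r2 E \<Delta> P1 G1 G2 Q x * \<delta>"
      using \<delta> by (auto simp: ell2_def ell3_def ell4_def r1_def r2_def)
    ultimately show "r3 E P1 * \<delta>\<^sup>2 - C * (vnorm x)\<^sup>2
        \<le> ell X1 E \<Delta> \<Omega> P1 G1 G2 Q x + gfun X1 E \<Delta> P1 G1 G2 Q x \<delta>"
      unfolding ell_def gfun_def C_def R_def[symmetric] distrib_right by linarith
  qed
qed

lemma eventually_norm_to_zero:
  assumes "eventually P (norm_to_zero n)"
  shows "\<exists>b>0. \<forall>x\<in>carrier_vec n. 0 < vnorm x \<longrightarrow> vnorm x < b \<longrightarrow> P x"
proof -
  obtain p where p: "eventually p (at_right (0::real))" "\<And>x. p (vnorm x) \<Longrightarrow> x \<in> carrier_vec n \<Longrightarrow> P x"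
    using assms by (auto simp: norm_to_zero_def eventually_inf_principal eventually_filtercomap)
  from p(1) obtain b where "0 < b" "\<And>y. 0 < y \<Longrightarrow> y < b \<Longrightarrow> p y"
    by (auto simp: eventually_at_right_field)
  with p(2) show ?thesis by blast
qed

text \<open>Since \<open>|Q x| = o(|x|)\<close>, every term of \<open>\<ell> + g\<close> except the constant \<open>r\<^sub>3 \<delta>\<^sup>2\<close> is nonnegative
  or vanishes as \<open>x\<close> tends to zero along an axis. The point \<open>x = 0\<close> itself is of no use, because
  the limit leaves \<open>Q 0\<close> unconstrained.\<close>

lemma ell_gfun_positive_near_zero:
  assumes n: "0 < n" and P1: "pos_def n P1" and E: "E \<in> carrier_mat n s" "E \<noteq> 0\<^sub>m n s"
    and X1: "X1 \<in> carrier_mat n T" and G: "G1 \<in> carrier_mat T n" "G2 \<in> carrier_mat T q"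
    and \<Omega>: "\<Omega> \<in> carrier_mat n n" and \<delta>: "0 < \<delta>" and \<gamma>: "0 < \<gamma>"
    and Q: "\<And>x. x \<in> carrier_vec n \<Longrightarrow> Q x \<in> carrier_vec q"
    and lim: "((\<lambda>x. vnorm (Q x) / vnorm x) \<longlongrightarrow> 0) (norm_to_zero n)"
  obtains x where "x \<in> sublevel n P1 \<gamma>"
    "0 < ell X1 E \<Delta> \<Omega> P1 G1 G2 Q x + gfun X1 E \<Delta> P1 G1 G2 Q x \<delta>"
proof -
  obtain C where C: "\<And>x. x \<in> carrier_vec n \<Longrightarrow> Q x \<in> carrier_vec q \<Longrightarrow> vnorm (Q x) \<le> vnorm x \<Longrightarrow>
    r3 E P1 * \<delta>\<^sup>2 - C * (vnorm x)\<^sup>2 \<le> ell X1 E \<Delta> \<Omega> P1 G1 G2 Q x + gfun X1 E \<Delta> P1 G1 G2 Q x \<delta>"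
    using ell_gfun_lower[OF P1 X1 G \<Omega> less_imp_le[OF \<delta>], of Q E \<Delta>] by blast
  \<comment> \<open>The threshold 1 for the quotient is the condition |Q(x)| \<le> |x| of
    \<open>ell_gfun_lower\<close>.\<close>
  have ev: "eventually (\<lambda>x. vnorm (Q x) / vnorm x < 1) (norm_to_zero n)"
    using order_tendstoD(2)[OF lim] by simp
  obtain b where b: "0 < b" "\<And>x. x \<in> carrier_vec n \<Longrightarrow> 0 < vnorm x \<Longrightarrow> vnorm x < b \<Longrightarrow> vnorm (Q x) / vnorm x < 1"
    using eventually_norm_to_zero[OF ev] by blast
  have r3: "0 < r3 E P1 * \<delta>\<^sup>2"
    using norm2_transpose_mult_pos[OF pos_def_minv(3)[OF P1] E] \<delta> by (simp add: r3_def)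
  have Rc: "minv P1 \<in> carrier_mat n n" by (rule sym_matD[OF pos_defD(1)[OF pos_def_minv(3)[OF P1]]])
  have sq: "((\<lambda>t. c * t\<^sup>2) \<longlongrightarrow> 0) (at_right (0::real))" for c :: real
    by (auto intro!: tendsto_eq_intros)
  \<comment> \<open>Three demands on the distance t of the point from the origin: V stays below
    \<gamma>, the quadratic loss stays below the constant term, and t lies in the punctured
    neighbourhood where Q is small.\<close>
  have ev_t: "eventually (\<lambda>t. norm2 (minv P1) * t\<^sup>2 < \<gamma> \<and> C * t\<^sup>2 < r3 E P1 * \<delta>\<^sup>2 \<and> t \<in> {0<..<b}) (at_right (0::real))"
    using order_tendstoD(2)[OF sq \<gamma>] order_tendstoD(2)[OF sq r3] eventually_at_right_real[OF b(1)]
    by (intro eventually_conj)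
  obtain t where t: "norm2 (minv P1) * t\<^sup>2 < \<gamma>" "C * t\<^sup>2 < r3 E P1 * \<delta>\<^sup>2" "0 < t" "t < b"
    using eventually_happens'[OF trivial_limit_at_right_real ev_t] by auto
  define x where "x = t \<cdot>\<^sub>v unit_vec n 0"
  have x: "x \<in> carrier_vec n" by (simp add: x_def)
  have "vnorm (unit_vec n 0) = 1" using n by (simp add: vnorm_def)
  then have nx: "vnorm x = t" using t by (simp add: x_def vnorm_smult)
  have "vnorm (Q x) \<le> vnorm x" using b(2)[OF x] nx t by (simp add: divide_simps)
  from C[OF x Q[OF x] this] t nx
  have "0 < ell X1 E \<Delta> \<Omega> P1 G1 G2 Q x + gfun X1 E \<Delta> P1 G1 G2 Q x \<delta>" by simp
  moreover have "lyap P1 x \<le> \<gamma>"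
  proof -
    have "lyap P1 x \<le> vnorm x * vnorm (minv P1 *\<^sub>v x)"
      using abs_scalar_prod_le[OF x, of "minv P1 *\<^sub>v x"] Rc x by (simp add: lyap_def)
    also have "\<dots> \<le> vnorm x * (norm2 (minv P1) * vnorm x)"
      by (intro mult_left_mono vnorm_mult_mat_vec_le[OF Rc x]) simp
    finally show ?thesis using t nx by (simp add: power2_eq_square ac_simps)
  qed
  ultimately show thesis using that x by (simp add: sublevel_def)
qed

theorem theorem7:
  fixes n m s S T :: nat
    and A B E :: "real mat"
    and Q :: "real vec \<Rightarrow> real vec"
    and xs us ds :: "nat \<Rightarrow> real vec"
    and \<delta> \<epsilon> \<gamma> :: real
    and \<Omega> \<Delta> U0 X1 Z0 P1 Y1 G1 G2 K :: "real mat"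
    and X\<^sub>s Z\<^sub>s D\<^sub>s :: "real vec set"
  assumes "0 < n" "0 < m" "0 < s" "0 < T" "n \<le> S"
    and "A \<in> carrier_mat n S" "B \<in> carrier_mat n m" "E \<in> carrier_mat n s"
    and "\<And>x. x \<in> carrier_vec n \<Longrightarrow> Q x \<in> carrier_vec (S - n)"
    and "nonlinear_components n (S - n) Q"
    and "((\<lambda>x. vnorm (Q x) / vnorm x) \<longlongrightarrow> 0) (norm_to_zero n)"
    and "\<And>k. k \<le> T \<Longrightarrow> xs k \<in> carrier_vec n"
    and "\<And>k. k < T \<Longrightarrow> us k \<in> carrier_vec m"
    and "\<And>k. k < T \<Longrightarrow> ds k \<in> carrier_vec s"
    and "\<And>k. k < T \<Longrightarrow> xs (Suc k) = A *\<^sub>v Zmap Q (xs k) + B *\<^sub>v us k + E *\<^sub>v ds k"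
    and "0 < \<delta>"
    and "\<And>k. k < T \<Longrightarrow> vnorm (ds k) \<le> \<delta>"
    and "U0 = data_mat m T us"
    and "X1 = data_mat n T (\<lambda>k. xs (Suc k))"
    and "Z0 = data_mat S T (\<lambda>k. Zmap Q (xs k))"
    and "\<Delta> = (\<delta> * sqrt (real T)) \<cdot>\<^sub>m 1\<^sub>m s"
    and "pos_def n \<Omega>"
    and "sdp_feasible n (S - n) T Z0 X1 E \<Delta> \<Omega> P1 Y1 G2 \<epsilon>"
    and "G1 = Y1 * minv P1"
    and "K = U0 * append_cols G1 G2"
    and "0 < \<gamma>"
    and "X\<^sub>s = {x \<in> carrier_vec n. ell X1 E \<Delta> \<Omega> P1 G1 G2 Q x + gfun X1 E \<Delta> P1 G1 G2 Q x \<delta> \<le> 0}"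
    and "Z\<^sub>s = sublevel n P1 \<gamma> \<inter> (carrier_vec n - X\<^sub>s)"
    and "D\<^sub>s = {d \<in> carrier_vec s. vnorm d \<le> \<delta>}"
  shows "(\<forall>x\<in>sublevel n P1 \<gamma>. \<forall>d\<in>D\<^sub>s.
            0 < lyap P1 (closed_loop A B E K Q x d) - lyap P1 x \<longrightarrow> x \<in> Z\<^sub>s)
       \<and> (E \<noteq> 0\<^sub>m n s \<longrightarrow> Z\<^sub>s \<noteq> {})
       \<and> ((\<forall>x\<in>Z\<^sub>s. lyap P1 x + ell X1 E \<Delta> \<Omega> P1 G1 G2 Q x + gfun X1 E \<Delta> P1 G1 G2 Q x \<delta> \<le> \<gamma>)
            \<longrightarrow> robustly_positively_invariant (closed_loop A B E K Q) D\<^sub>s (sublevel n P1 \<gamma>))"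
proof -
  note n = assms(1) and c = assms(6-8) and Q = assms(9) and lim = assms(11)
    and \<delta> = assms(16) and U0 = assms(18) and X1 = assms(19) and Z0 = assms(20) and \<Delta> = assms(21)
    and \<Omega> = assms(22) and G1 = assms(24) and K = assms(25) and \<gamma> = assms(26)
    and Xs = assms(27) and Zs = assms(28) and Ds = assms(29)
  define q where "q = S - n"
  have S: "S = n + q" using assms(5) by (simp add: q_def)
  have Qc: "Q x \<in> carrier_vec q" if "x \<in> carrier_vec n" for x using Q[OF that] by (simp add: q_def)
  have sdp: "sym_mat n P1" "Y1 \<in> carrier_mat T n" "G2 \<in> carrier_mat T q" "0 < \<epsilon>"
    "Z0 * Y1 = P1 @\<^sub>r 0\<^sub>m q n" "Z0 * G2 = 0\<^sub>m n q @\<^sub>r 1\<^sub>m q"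
    "pos_def (n + n + T) (lmi_mat n T X1 E \<Delta> \<Omega> P1 Y1 \<epsilon>)"
    using assms(23) by (simp_all add: sdp_feasible_def q_def)
  define D where "D = data_mat s T ds"
  define \<beta> where "\<beta> = \<delta> * sqrt (real T)"
  \<comment> \<open>\<open>\<beta>\<close> bounds the data disturbance in the matrix inequality,
    while \<ell> and g are written with \<open>norm2 \<Delta>\<close>; the second fact links the
    two.\<close>
  have \<beta>: "0 \<le> \<beta>" "\<beta> \<le> norm2 \<Delta>"
    using \<delta> norm2_smult_one_ge[OF assms(3), of \<beta>] by (simp_all add: \<beta>_def \<Delta>)
  have Dc: "D \<in> carrier_mat s T" and X1c: "X1 \<in> carrier_mat n T" and Z0c: "Z0 \<in> carrier_mat S T"
    and U0c: "U0 \<in> carrier_mat m T" by (simp_all add: D_def X1 Z0 U0)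
  have DT: "vnorm (transpose_mat D *\<^sub>v z) \<le> \<beta> * vnorm z" if "z \<in> carrier_vec s" for z
    unfolding D_def \<beta>_def using assms(14,17) \<delta> that by (intro vnorm_transpose_data_mat_le) auto
  have Db: "vnorm (D *\<^sub>v v) \<le> norm2 \<Delta> * vnorm v" if "v \<in> carrier_vec T" for v
    using vnorm_mult_le_of_transpose[OF Dc \<beta>(1) DT that] mult_right_mono[OF \<beta>(2), of "vnorm v"] by simp
  \<comment> \<open>One matrix with two readings: as \<open>X1 - E * D\<close> it fits the matrix
    inequality and the step bound, as \<open>A * Z0 + B * U0\<close> it drives the closed
    loop.\<close>
  define F where "F = X1 - E * D"
  have F: "F = A * Z0 + B * U0"
    unfolding F_def X1 Z0 U0 D_def using assms(12-15) c Qc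
    by (intro data_identity) (auto simp: Zmap_def S)
  have Fc: "F \<in> carrier_mat n T" unfolding F_def using c Dc by (intro minus_carrier_mat) simp
  have \<Omega>c: "\<Omega> \<in> carrier_mat n n" by (rule sym_matD[OF pos_defD(1)[OF \<Omega>]])
  have lmi: "0 \<le> a \<bullet> (P1 *\<^sub>v a) - a \<bullet> (\<Omega> *\<^sub>v a) + 2 * (b \<bullet> (F *\<^sub>v (Y1 *\<^sub>v a))) + b \<bullet> (P1 *\<^sub>v b)"
    if "a \<in> carrier_vec n" "b \<in> carrier_vec n" for a b
    unfolding F_def
    using lmi_robust[OF sdp(7) sym_matD[OF sdp(1)] \<Omega>c X1c sdp(2) c(3) Dc \<Delta>[folded \<beta>_def] sdp(4) DT that]
    by simp
  have P1: "pos_def n P1" by (rule lmi_pos_def[OF lmi sdp(1) \<Omega> Fc sdp(2)])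
  have Rc: "minv P1 \<in> carrier_mat n n" by (rule sym_matD[OF pos_defD(1)[OF pos_def_minv(3)[OF P1]]])
  have G1c: "G1 \<in> carrier_mat T n" using sdp(2) Rc by (simp add: G1)
  let ?g = "\<lambda>x. ell X1 E \<Delta> \<Omega> P1 G1 G2 Q x + gfun X1 E \<Delta> P1 G1 G2 Q x \<delta>"
  have loop: "closed_loop A B E K Q x d = F *\<^sub>v (G1 *\<^sub>v x + G2 *\<^sub>v Q x) + E *\<^sub>v d"
    if "x \<in> carrier_vec n" for x d
    unfolding K G1 F
    by (rule closed_loop_data[where Q = Q, OF c(1)[unfolded S] c(2) U0c Z0c[unfolded S] sdp(2,3) Rc
        sym_matD[OF sdp(1)] pos_def_minv(1)[OF P1] sdp(5,6) that Qc[OF that]])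
  have step: "closed_loop A B E K Q x d \<in> carrier_vec n"
      "lyap P1 (closed_loop A B E K Q x d) \<le> lyap P1 x + ?g x"
    if x: "x \<in> carrier_vec n" and d: "d \<in> D\<^sub>s" for x d
  proof -
    have d': "d \<in> carrier_vec s" "vnorm d \<le> \<delta>" using d by (auto simp: Ds)
    show "closed_loop A B E K Q x d \<in> carrier_vec n"
      unfolding loop[OF x]
      by (intro add_carrier_vec mult_mat_vec_carrier[OF Fc] mult_mat_vec_carrier[OF c(3)]
          mult_mat_vec_carrier[OF G1c] mult_mat_vec_carrier[OF sdp(3)] x Qc d')
    show "lyap P1 (closed_loop A B E K Q x d) \<le> lyap P1 x + ?g x"
      unfolding add.assoc[symmetric]
      by (rule lyap_step[where Q = Q, OF P1 c(3) X1c Dc G1c sdp(3) Db x Qc[OF x] d'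
            lmi_decrease[OF lmi P1 \<Omega>c Fc sdp(2) x refl, folded G1, unfolded F_def] loop[OF x, unfolded F_def]])
  qed
  have "x \<in> Z\<^sub>s" if "x \<in> sublevel n P1 \<gamma>" "d \<in> D\<^sub>s" "0 < lyap P1 (closed_loop A B E K Q x d) - lyap P1 x" for x d
    using step(2)[of x d] that by (auto simp: Zs Xs sublevel_def)
  \<comment> \<open>The condition on \<open>E\<close> excludes a degenerate case: for
    \<open>E = 0\<close> and \<open>S = n\<close> the sum \<ell> + g is just minus the
    \<open>\<Omega>\<close> form, and the set is empty.\<close>
  moreover have "Z\<^sub>s \<noteq> {}" if E: "E \<noteq> 0\<^sub>m n s"
  proof -
    obtain x where "x \<in> sublevel n P1 \<gamma>" "0 < ?g x"
      using ell_gfun_positive_near_zero[where Q = Q, OF n P1 c(3) E X1c G1c sdp(3) \<Omega>c \<delta> \<gamma> Qc lim] by blast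
    then have "x \<in> Z\<^sub>s" by (auto simp: Zs Xs sublevel_def)
    then show ?thesis by blast
  qed
  moreover have "robustly_positively_invariant (closed_loop A B E K Q) D\<^sub>s (sublevel n P1 \<gamma>)"
    if H: "\<forall>x\<in>Z\<^sub>s. lyap P1 x + ell X1 E \<Delta> \<Omega> P1 G1 G2 Q x + gfun X1 E \<Delta> P1 G1 G2 Q x \<delta> \<le> \<gamma>"
  proof -
    have one: "closed_loop A B E K Q x d \<in> sublevel n P1 \<gamma>" if x: "x \<in> sublevel n P1 \<gamma>" and d: "d \<in> D\<^sub>s" for x d
    proof -
      have xc: "x \<in> carrier_vec n" and "lyap P1 x \<le> \<gamma>" using x by (auto simp: sublevel_def)
      then have "lyap P1 x + ?g x \<le> \<gamma>"
        using H x by (cases "x \<in> X\<^sub>s") (auto simp: Zs Xs add.assoc)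
      then show ?thesis using step[OF xc d] by (simp add: sublevel_def)
    qed
    show ?thesis unfolding robustly_positively_invariant_def
    proof (intro allI impI)
      fix x d and t :: nat
      assume H: "x 0 \<in> sublevel n P1 \<gamma> \<and> (\<forall>t::nat. d t \<in> D\<^sub>s) \<and> (\<forall>t. x (Suc t) = closed_loop A B E K Q (x t) (d t))"
      \<comment> \<open>Time 0 is included as the base of the induction.\<close>
      show "x t \<in> sublevel n P1 \<gamma>"
        using H one by (induction t) auto
    qed
  qed
  ultimately show ?thesis by blast
qed

end
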